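(* Let $X_1,X_2,\dots$ be i.i.d. real random variables with a square integrable probability density $f$ and characteristic function $\varphi$. Let $K$ be a symmetric, square integrable probability density on $\mathbb{R}$, let $\hat f_n(x;h)$ be the kernel estimator of $f$ based on $K$, and let $f_n(x;h)$ be the sinc estimator of $f$. Suppose that $$|\varphi(t)|=o\left(\frac{1}{t^{5/2}}\right)\quad\text{as } t\to\infty .$$ Then $$\inf_{h>0}\mathrm{MISE}(f_n(x;h))=o\left(\inf_{h>0}\mathrm{MISE}(\hat f_n(x;h))\right)\quad\text{as } n\to\infty .$$
   Context: The characteristic function is $\varphi(t)=\mathrm{E}\,e^{itX_j}$. For bandwidth $h>0$ the kernel estimator of $f$ based on $K$ is $\hat f_n(x;h)=\frac{1}{nh}\sum_{j=1}^n K\left(\frac{x-X_j}{h}\right)$. The sinc estimator is $f_n(x;h)=\frac{1}{\pi n}\sum_{j=1}^n\frac{\sin[(x-X_j)/h]}{x-X_j}$ (i.e. the kernel estimator with the sinc kernel $K_s(x)=\frac{\sin x}{\pi x}$, $K_s(0)=1/\pi$). For an estimator $\hat g_n$ of $f$, $\mathrm{MISE}(\hat g_n)=\mathrm{E}\int_{-\infty}^{\infty}[\hat g_n(x)-f(x)]^2\,dx$. *)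

theory Defs
  imports "HOL-Probability.Probability" "HOL-Library.Landau_Symbols"
begin

definition prob_density :: "(real \<Rightarrow> real) \<Rightarrow> bool" where
  "prob_density f \<longleftrightarrow>
     f \<in> borel_measurable borel \<and> (\<forall>x. 0 \<le> f x) \<and> (\<integral>\<^sup>+x. ennreal (f x) \<partial>lborel) = 1"

definition square_integrable :: "(real \<Rightarrow> real) \<Rightarrow> bool" where
  "square_integrable f \<longleftrightarrow> f \<in> borel_measurable borel \<and> integrable lborel (\<lambda>x. (f x)\<^sup>2)"

text \<open>The sample is \<open>xs 1, \<dots>, xs n\<close>; the value \<open>xs 0\<close> is not used.\<close>

definition kernel_estimator ::
    "(real \<Rightarrow> real) \<Rightarrow> (nat \<Rightarrow> real) \<Rightarrow> nat \<Rightarrow> real \<Rightarrow> real \<Rightarrow> real" where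
  "kernel_estimator K xs n h x = 1 / (real n * h) * (\<Sum>j=1..n. K ((x - xs j) / h))"

definition sinc_kernel :: "real \<Rightarrow> real" where
  "sinc_kernel x = (if x = 0 then 1 / pi else sin x / (pi * x))"

definition sinc_estimator :: "(nat \<Rightarrow> real) \<Rightarrow> nat \<Rightarrow> real \<Rightarrow> real \<Rightarrow> real" where
  "sinc_estimator xs n h x = kernel_estimator sinc_kernel xs n h x"

text \<open>Off the sample points this is the usual explicit formula; at a sample point the quotient
  is read as its limit \<open>1 / h\<close>.\<close>

lemma sinc_estimator_explicit:
  assumes "h > 0" "\<And>j. j \<in> {1..n} \<Longrightarrow> x \<noteq> xs j"
  shows "sinc_estimator xs n h x = 1 / (pi * real n) * (\<Sum>j=1..n. sin ((x - xs j) / h) / (x - xs j))"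
proof -
  have "sinc_kernel ((x - xs j) / h) = h / pi * (sin ((x - xs j) / h) / (x - xs j))"
    if "j \<in> {1..n}" for j
    using assms(1) assms(2)[OF that] by (simp add: sinc_kernel_def)
  then have "(\<Sum>j=1..n. sinc_kernel ((x - xs j) / h))
      = h / pi * (\<Sum>j=1..n. sin ((x - xs j) / h) / (x - xs j))"
    by (simp add: sum_distrib_left)
  then show ?thesis
    using assms(1) by (simp add: sinc_estimator_def kernel_estimator_def)
qed

text \<open>The integrand is nonnegative, so the MISE is taken in \<open>[0, \<infinity>]\<close> and no integrability
  is needed for it to make sense. The estimator \<open>g\<close> depends on the outcome \<open>\<omega>\<close> through the
  sample. For square integrable kernels and densities and \<open>h > 0\<close> the value is finite, so
  \<open>enn2real\<close> loses nothing there.\<close>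

definition MISE :: "'a measure \<Rightarrow> ('a \<Rightarrow> real \<Rightarrow> real) \<Rightarrow> (real \<Rightarrow> real) \<Rightarrow> ennreal" where
  "MISE M g f = (\<integral>\<^sup>+\<omega>. (\<integral>\<^sup>+x. ennreal ((g \<omega> x - f x)\<^sup>2) \<partial>lborel) \<partial>M)"

end

theory Submission
  imports Defs "HOL-Real_Asymp.Real_Asymp"
begin

text \<open>
  Both risks are compared with the rate \<open>n powr (- 4 / 5)\<close>. For any square integrable kernel
  \<open>q\<close> with the bandwidth absorbed, the risk is the integrated squared bias plus the integrated
  variance, both explicit in terms of \<open>q\<close> and the law \<open>\<mu>\<close> of the observations
  (\<open>MISE_sample_average\<close>).

  A kernel \<open>K\<close> that is a probability density has a characteristic function with
  \<open>\<bar>1 - char u\<bar> \<ge> c * u\<^sup>2\<close> near the origin (\<open>one_minus_char_ge_square\<close>), which forces a squared bias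
  of at least order \<open>h ^ 4\<close> for bounded \<open>h\<close>, however smooth the sampled density may be, and a
  large \<open>h\<close> leaves a squared bias of constant order. The variance is of order
  \<open>1 / (n * h)\<close>, and balancing the two shows that no bandwidth beats \<open>n powr (- 4 / 5)\<close> by more
  than a constant factor (\<open>kernel_risk_lower_bound\<close>).

  The sinc kernel instead reproduces all frequencies up to \<open>1 / h\<close> exactly. Its squared bias is governed by
  the tail of the squared characteristic function beyond \<open>1 / h\<close> (\<open>sinc_bias_le_tail\<close>), which under the decay
  \<open>o(1 / t powr (5 / 2))\<close> is \<open>o(h ^ 4)\<close>. A bandwidth \<open>D * n powr (- 1 / 5)\<close> with a large constant
  \<open>D\<close> therefore gives a risk of at most \<open>\<epsilon> * n powr (- 4 / 5)\<close>
  (\<open>sinc_risk_upper_bound\<close>).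

  In the frequency domain, both bounds rest on a single inequality, one half of Plancherel's identity
  (\<open>bessel_fourier\<close>). For the lower bound it is applied to the bias, for the upper bound to the part of the
  characteristic function that is cut off. The latter also needs Fourier inversion for a density with
  integrable characteristic function (\<open>inverse_char_density\<close>), which is derived from Levy's
  inversion formula.
\<close>

section \<open>A Bessel inequality for Fourier integrals\<close>

text \<open>The sign in the exponent is that of \<open>char\<close> and there is no constant in front, so that the
  transform of a density is its characteristic function.\<close>

definition fourier :: "(real \<Rightarrow> complex) \<Rightarrow> real \<Rightarrow> complex" where
  "fourier F t = (CLINT x|lborel. F x * iexp (t * x))"

lemma fourier_integrable:
  assumes "integrable lborel F"
  shows "integrable lborel (\<lambda>x. F x * iexp (t * x))"
proof -
  have [measurable]: "F \<in> borel_measurable borel" using assms by (simp add: integrable_iff_bounded)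
  show ?thesis
    by (rule Bochner_Integration.integrable_bound[OF assms]) (auto simp: norm_mult)
qed

lemma fourier_measurable [measurable]:
  assumes [measurable]: "F \<in> borel_measurable borel"
  shows "fourier F \<in> borel_measurable borel"
  unfolding fourier_def by measurable

lemma integrable_tensor:
  fixes F G :: "real \<Rightarrow> complex"
  assumes F: "integrable lborel F" and G: "integrable lborel G"
  shows "integrable (lborel \<Otimes>\<^sub>M lborel) (\<lambda>(x, y). F x * G y)"
proof -
  have [measurable]: "F \<in> borel_measurable borel" "G \<in> borel_measurable borel"
    using F G by (simp_all add: integrable_iff_bounded)
  show ?thesis
    using F G by (intro lborel_pair.Fubini_integrable) (auto simp: norm_mult)
qed

text \<open>Written as a double integral, the squared modulus depends on the frequency only through
  an exponential, so averaging it over a random frequency produces a characteristic function.\<close>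

lemma cmod_fourier_square:
  assumes F: "integrable lborel F"
  shows "complex_of_real ((cmod (fourier F t))\<^sup>2)
    = (CLINT p|lborel \<Otimes>\<^sub>M lborel. F (fst p) * cnj (F (snd p)) * iexp (t * (fst p - snd p)))"
proof -
  let ?G = "\<lambda>y. cnj (F y * iexp (t * y))"
  have G: "integrable lborel ?G"
    by (rule integrable_cnj[OF fourier_integrable[OF F]])
  have "complex_of_real ((cmod (fourier F t))\<^sup>2) = fourier F t * cnj (fourier F t)"
    by (simp add: complex_norm_square[symmetric])
  also have "\<dots> = (CLINT x|lborel. (F x * iexp (t * x)) * (CLINT y|lborel. ?G y))"
    unfolding fourier_def by (simp only: integral_mult_left_zero Bochner_Integration.integral_cnj)
  also have "\<dots> = (CLINT x|lborel. CLINT y|lborel. (F x * iexp (t * x)) * ?G y)"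
    by simp
  also have "\<dots> = (CLINT p|lborel \<Otimes>\<^sub>M lborel. (\<lambda>(x, y). (F x * iexp (t * x)) * ?G y) p)"
    using lborel_pair.integral_fst[OF integrable_tensor[OF fourier_integrable[OF F, of t] G]] by simp
  also have "\<dots> = (CLINT p|lborel \<Otimes>\<^sub>M lborel. F (fst p) * cnj (F (snd p)) * iexp (t * (fst p - snd p)))"
    by (intro Bochner_Integration.integral_cong)
       (auto simp: exp_cnj exp_diff exp_minus algebra_simps divide_inverse)
  finally show ?thesis .
qed

lemma gaussian_nn_integral:
  assumes "s > 0"
  shows "(\<integral>\<^sup>+y. ennreal (exp (- (s * (x - y))\<^sup>2 / 2)) \<partial>lborel) = ennreal (sqrt (2 * pi) / s)"
proof -
  have "(\<integral>\<^sup>+y. ennreal (std_normal_density y) \<partial>lborel) = 1"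
    using prob_space.emeasure_space_1[OF prob_space_normal_density[of 1 0]]
    by (simp add: emeasure_density)
  then have "1 = ennreal s * (\<integral>\<^sup>+y. ennreal (std_normal_density (- (s * x) + s * y)) \<partial>lborel)"
    using nn_integral_real_affine[of "\<lambda>y. ennreal (std_normal_density y)" s "- (s * x)"] assms by simp
  also have "(\<integral>\<^sup>+y. ennreal (std_normal_density (- (s * x) + s * y)) \<partial>lborel)
     = (\<integral>\<^sup>+y. ennreal (1 / sqrt (2 * pi)) * ennreal (exp (- (s * (x - y))\<^sup>2 / 2)) \<partial>lborel)"
    by (intro nn_integral_cong, subst ennreal_mult[symmetric])
       (auto simp: std_normal_density_def power2_eq_square algebra_simps)
  also have "\<dots> = ennreal (1 / sqrt (2 * pi)) * (\<integral>\<^sup>+y. ennreal (exp (- (s * (x - y))\<^sup>2 / 2)) \<partial>lborel)"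
    by (rule nn_integral_cmult) auto
  finally have "ennreal (sqrt (2 * pi) / s) = ennreal (sqrt (2 * pi) / s) * (ennreal s * (ennreal (1 / sqrt (2 * pi)) *
     (\<integral>\<^sup>+y. ennreal (exp (- (s * (x - y))\<^sup>2 / 2)) \<partial>lborel)))" by simp
  also have "\<dots> = ennreal (sqrt (2 * pi) / s * s * (1 / sqrt (2 * pi))) *
     (\<integral>\<^sup>+y. ennreal (exp (- (s * (x - y))\<^sup>2 / 2)) \<partial>lborel)"
    using assms by (simp only: ennreal_mult mult.assoc divide_nonneg_nonneg real_sqrt_ge_zero
      zero_le_one mult_nonneg_nonneg less_imp_le pi_ge_zero zero_le_numeral)
  also have "sqrt (2 * pi) / s * s * (1 / sqrt (2 * pi)) = 1" using assms by simp
  finally show ?thesis by simp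
qed

text \<open>Averaged over a Gaussian frequency, \<open>cmod (fourier F t) ^ 2\<close> is a double integral of
  \<open>F x * cnj (F y)\<close> against the Gaussian characteristic function at \<open>s * (x - y)\<close>. The bound
  \<open>2 * a * b \<le> a\<^sup>2 + b\<^sup>2\<close> separates the two variables, and the Gaussian integrates out.\<close>

lemma std_normal_fourier_bound:
  assumes F: "integrable lborel F" and "s > 0"
  shows "(\<integral>\<^sup>+t. ennreal ((cmod (fourier F (s * t)))\<^sup>2) \<partial>std_normal_distribution)
    \<le> ennreal (sqrt (2 * pi) / s) * (\<integral>\<^sup>+x. ennreal ((cmod (F x))\<^sup>2) \<partial>lborel)"
proof -
  let ?N = "std_normal_distribution" and ?L = "lborel \<Otimes>\<^sub>M lborel :: (real \<times> real) measure"
  interpret N: prob_space ?N by (rule prob_space_normal_density) simp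
  interpret PL: sigma_finite_measure ?L by (rule lborel_pair.sigma_finite_measure_axioms)
  interpret P: pair_sigma_finite ?N ?L ..
  have [measurable]: "F \<in> borel_measurable borel" using F by (simp add: integrable_iff_bounded)
  have [measurable]: "cnj \<in> borel_measurable borel"
    by (intro borel_measurable_continuous_onI continuous_intros)
  let ?H = "\<lambda>p. F (fst p) * cnj (F (snd p))" and ?d = "\<lambda>p. s * (fst p - snd p) :: real"
  let ?g = "\<lambda>p. exp (- (?d p)\<^sup>2 / 2)"
  have charN: "(CLINT t|?N. iexp (t * u)) = complex_of_real (exp (- u\<^sup>2 / 2))" for u
    using fun_cong[OF char_std_normal_distribution, of u] by (simp add: char_def mult.commute)
  have H: "integrable ?L ?H"
    using integrable_tensor[OF F integrable_cnj[OF F]] by (simp only: case_prod_beta')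
  have "integrable ?L (\<lambda>p. ?H p * iexp (t * ?d p))" for t
    by (rule Bochner_Integration.integrable_bound[OF H]) (measurable, auto simp: norm_mult)
  then have joint: "integrable (?N \<Otimes>\<^sub>M ?L) (\<lambda>(t, p). ?H p * iexp (t * ?d p))"
    by (intro P.Fubini_integrable) (auto simp: norm_mult)
  have Hexp: "(CLINT p|?L. ?H p * iexp (t * ?d p)) = complex_of_real ((cmod (fourier F (s * t)))\<^sup>2)" for t
    by (subst cmod_fourier_square[OF F]) (simp add: mult.assoc mult.left_commute)
  have "integrable ?N (\<lambda>t. complex_of_real ((cmod (fourier F (s * t)))\<^sup>2))"
    using P.integrable_fst[OF joint] by (simp only: Hexp)
  then have intN: "integrable ?N (\<lambda>t. (cmod (fourier F (s * t)))\<^sup>2)"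
    by (simp only: complex_of_real_integrable_eq)
  have "complex_of_real (LINT t|?N. (cmod (fourier F (s * t)))\<^sup>2)
      = (CLINT t|?N. CLINT p|?L. ?H p * iexp (t * ?d p))"
    by (simp only: Hexp integral_complex_of_real)
  also have "\<dots> = (CLINT p|?L. CLINT t|?N. ?H p * iexp (t * ?d p))"
    using P.Fubini_integral[OF joint] by simp
  also have "\<dots> = (CLINT p|?L. ?H p * complex_of_real (?g p))"
    by (simp only: integral_mult_right_zero charN)
  finally have eq: "complex_of_real (LINT t|?N. (cmod (fourier F (s * t)))\<^sup>2) = \<dots>" .
  have "(\<integral>\<^sup>+t. ennreal ((cmod (fourier F (s * t)))\<^sup>2) \<partial>?N) = ennreal (LINT t|?N. (cmod (fourier F (s * t)))\<^sup>2)"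
    by (intro nn_integral_eq_integral intN) simp
  also have "(LINT t|?N. (cmod (fourier F (s * t)))\<^sup>2) = cmod (CLINT p|?L. ?H p * complex_of_real (?g p))"
    unfolding eq[symmetric] by simp
  also have "ennreal \<dots> \<le> (\<integral>\<^sup>+p. ennreal (cmod (?H p * complex_of_real (?g p))) \<partial>?L)"
  proof (rule integral_norm_bound_ennreal)
    show "integrable ?L (\<lambda>p. ?H p * complex_of_real (?g p))"
    proof (rule Bochner_Integration.integrable_bound[OF H])
      show "AE p in ?L. cmod (?H p * complex_of_real (?g p)) \<le> cmod (?H p)"
        by (simp add: norm_mult mult_left_le)
    qed measurable
  qed
  also have "\<dots> \<le> (\<integral>\<^sup>+p. ennreal ((cmod (F (fst p)))\<^sup>2 / 2) * ennreal (?g p)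
      + ennreal ((cmod (F (snd p)))\<^sup>2 / 2) * ennreal (?g p) \<partial>?L)"
  proof (rule nn_integral_mono)
    fix p
    have "0 \<le> (cmod (F (fst p)) - cmod (F (snd p)))\<^sup>2" by simp
    then have "cmod (F (fst p)) * cmod (F (snd p)) \<le> (cmod (F (fst p)))\<^sup>2 / 2 + (cmod (F (snd p)))\<^sup>2 / 2"
      by (simp add: power2_diff)
    then have "cmod (?H p * complex_of_real (?g p)) \<le> ((cmod (F (fst p)))\<^sup>2 / 2 + (cmod (F (snd p)))\<^sup>2 / 2) * ?g p"
      by (simp add: norm_mult mult_right_mono)
    then show "ennreal (cmod (?H p * complex_of_real (?g p))) \<le> ennreal ((cmod (F (fst p)))\<^sup>2 / 2) * ennreal (?g p)
      + ennreal ((cmod (F (snd p)))\<^sup>2 / 2) * ennreal (?g p)"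
      by (simp add: ennreal_mult'[symmetric] ennreal_plus[symmetric] distrib_right ennreal_leI del: ennreal_plus)
  qed
  also have "\<dots> = (\<integral>\<^sup>+p. ennreal ((cmod (F (fst p)))\<^sup>2 / 2) * ennreal (?g p) \<partial>?L)
      + (\<integral>\<^sup>+p. ennreal ((cmod (F (snd p)))\<^sup>2 / 2) * ennreal (?g p) \<partial>?L)"
    by (rule nn_integral_add) auto
  also have "(\<integral>\<^sup>+p. ennreal ((cmod (F (fst p)))\<^sup>2 / 2) * ennreal (?g p) \<partial>?L)
     = (\<integral>\<^sup>+x. \<integral>\<^sup>+y. ennreal ((cmod (F x))\<^sup>2 / 2) * ennreal (exp (- (s * (x - y))\<^sup>2 / 2)) \<partial>lborel \<partial>lborel)"
    by (subst lborel.nn_integral_fst[symmetric]) auto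
  also have "(\<integral>\<^sup>+p. ennreal ((cmod (F (snd p)))\<^sup>2 / 2) * ennreal (?g p) \<partial>?L)
     = (\<integral>\<^sup>+y. \<integral>\<^sup>+x. ennreal ((cmod (F y))\<^sup>2 / 2) * ennreal (exp (- (s * (x - y))\<^sup>2 / 2)) \<partial>lborel \<partial>lborel)"
    by (subst lborel_pair.nn_integral_snd[symmetric]) auto
  also have "\<dots> = (\<integral>\<^sup>+x. \<integral>\<^sup>+y. ennreal ((cmod (F x))\<^sup>2 / 2) * ennreal (exp (- (s * (x - y))\<^sup>2 / 2)) \<partial>lborel \<partial>lborel)"
    by (simp add: power_mult_distrib power2_commute)
  also have "(\<integral>\<^sup>+x. \<integral>\<^sup>+y. ennreal ((cmod (F x))\<^sup>2 / 2) * ennreal (exp (- (s * (x - y))\<^sup>2 / 2)) \<partial>lborel \<partial>lborel)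
      + (\<integral>\<^sup>+x. \<integral>\<^sup>+y. ennreal ((cmod (F x))\<^sup>2 / 2) * ennreal (exp (- (s * (x - y))\<^sup>2 / 2)) \<partial>lborel \<partial>lborel)
     = (\<integral>\<^sup>+x. ennreal ((cmod (F x))\<^sup>2 / 2) * ennreal (sqrt (2 * pi) / s)
         + ennreal ((cmod (F x))\<^sup>2 / 2) * ennreal (sqrt (2 * pi) / s) \<partial>lborel)"
    by (simp add: nn_integral_cmult gaussian_nn_integral[OF \<open>s > 0\<close>, simplified] nn_integral_add)
  also have "\<dots> = (\<integral>\<^sup>+x. ennreal (sqrt (2 * pi) / s) * ennreal ((cmod (F x))\<^sup>2) \<partial>lborel)"
    using \<open>s > 0\<close> by (intro nn_integral_cong)
      (simp add: ennreal_mult'[symmetric] ennreal_plus[symmetric] del: ennreal_plus)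
  finally show ?thesis by (simp add: nn_integral_cmult)
qed

text \<open>One half of Plancherel's identity. The constant in the Gaussian average of scale \<open>s\<close> cancels the normalisation of the density exactly, so as
  \<open>s\<close> tends to infinity the weight increases to 1 and Fatou's lemma gives the claim.\<close>

theorem bessel_fourier:
  assumes F: "integrable lborel F"
  shows "(\<integral>\<^sup>+t. ennreal ((cmod (fourier F t))\<^sup>2) \<partial>lborel)
    \<le> ennreal (2 * pi) * (\<integral>\<^sup>+x. ennreal ((cmod (F x))\<^sup>2) \<partial>lborel)"
proof -
  have [measurable]: "F \<in> borel_measurable borel" using F by (simp add: integrable_iff_bounded)
  let ?w = "\<lambda>s t. (cmod (fourier F t))\<^sup>2 * exp (- (t / s)\<^sup>2 / 2)"
  have bound: "(\<integral>\<^sup>+t. ennreal (?w s t) \<partial>lborel)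
     \<le> ennreal (2 * pi) * (\<integral>\<^sup>+x. ennreal ((cmod (F x))\<^sup>2) \<partial>lborel)" if "s > 0" for s :: real
  proof -
    have "(\<integral>\<^sup>+t. ennreal (?w s t) \<partial>lborel) = ennreal s * (\<integral>\<^sup>+t. ennreal (?w s (s * t)) \<partial>lborel)"
      using that nn_integral_real_affine[of "\<lambda>t. ennreal (?w s t)" s 0] by simp
    also have "(\<integral>\<^sup>+t. ennreal (?w s (s * t)) \<partial>lborel)
       = (\<integral>\<^sup>+t. ennreal (sqrt (2 * pi)) * (ennreal (std_normal_density t) * ennreal ((cmod (fourier F (s * t)))\<^sup>2)) \<partial>lborel)"
      using that by (intro nn_integral_cong) (simp add: ennreal_mult'[symmetric] std_normal_density_def mult.commute)
    also have "\<dots> = ennreal (sqrt (2 * pi)) * (\<integral>\<^sup>+t. ennreal ((cmod (fourier F (s * t)))\<^sup>2) \<partial>std_normal_distribution)"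
      by (simp add: nn_integral_cmult nn_integral_density)
    also have "ennreal s * \<dots> \<le> ennreal s * (ennreal (sqrt (2 * pi)) *
       (ennreal (sqrt (2 * pi) / s) * (\<integral>\<^sup>+x. ennreal ((cmod (F x))\<^sup>2) \<partial>lborel)))"
      by (intro mult_left_mono std_normal_fourier_bound[OF F that]) auto
    also have "\<dots> = ennreal (s * sqrt (2 * pi) * (sqrt (2 * pi) / s)) * (\<integral>\<^sup>+x. ennreal ((cmod (F x))\<^sup>2) \<partial>lborel)"
      using that by (simp only: ennreal_mult mult.assoc divide_nonneg_nonneg real_sqrt_ge_zero
        mult_nonneg_nonneg less_imp_le pi_ge_zero zero_le_numeral)
    also have "s * sqrt (2 * pi) * (sqrt (2 * pi) / s) = 2 * pi"
      using that by (simp add: field_simps)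
    finally show ?thesis .
  qed
  have lim: "(\<lambda>n. ennreal (?w (real (Suc n)) t)) \<longlonglongrightarrow> ennreal ((cmod (fourier F t))\<^sup>2)" for t
  proof -
    have "(\<lambda>n. t / real (Suc n)) \<longlonglongrightarrow> 0"
      using LIMSEQ_Suc[OF lim_const_over_n[of t]] by simp
    then have "(\<lambda>n. ?w (real (Suc n)) t) \<longlonglongrightarrow> (cmod (fourier F t))\<^sup>2 * exp (- 0\<^sup>2 / 2)"
      by (intro tendsto_intros) auto
    then show ?thesis by (simp add: tendsto_ennrealI)
  qed
  have "(\<integral>\<^sup>+t. ennreal ((cmod (fourier F t))\<^sup>2) \<partial>lborel)
     = (\<integral>\<^sup>+t. liminf (\<lambda>n. ennreal (?w (real (Suc n)) t)) \<partial>lborel)"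
    using lim_imp_Liminf[OF trivial_limit_sequentially lim] by simp
  also have "\<dots> \<le> liminf (\<lambda>n. \<integral>\<^sup>+t. ennreal (?w (real (Suc n)) t) \<partial>lborel)"
    by (rule nn_integral_liminf) measurable
  also have "\<dots> \<le> ennreal (2 * pi) * (\<integral>\<^sup>+x. ennreal ((cmod (F x))\<^sup>2) \<partial>lborel)"
    by (intro Liminf_le always_eventually allI bound) simp_all
  finally show ?thesis .
qed

definition inverse_fourier :: "(real \<Rightarrow> complex) \<Rightarrow> real \<Rightarrow> complex" where
  "inverse_fourier F x = 1 / (2 * pi) * (CLINT t|lborel. F t * iexp (- (t * x)))"

corollary bessel_inverse_fourier:
  assumes F: "integrable lborel F"
  shows "(\<integral>\<^sup>+x. ennreal ((cmod (inverse_fourier F x))\<^sup>2) \<partial>lborel)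
    \<le> ennreal (1 / (2 * pi)) * (\<integral>\<^sup>+t. ennreal ((cmod (F t))\<^sup>2) \<partial>lborel)"
proof -
  have [measurable]: "F \<in> borel_measurable borel" using F by (simp add: integrable_iff_bounded)
  have "(\<integral>\<^sup>+x. ennreal ((cmod (fourier F x))\<^sup>2) \<partial>lborel) = (\<integral>\<^sup>+x. ennreal ((cmod (fourier F (- x)))\<^sup>2) \<partial>lborel)"
    using nn_integral_real_affine[of "\<lambda>x. ennreal ((cmod (fourier F x))\<^sup>2)" "-1" 0] by simp
  also have "ennreal (1 / (2 * pi)\<^sup>2) * \<dots> = (\<integral>\<^sup>+x. ennreal ((cmod (inverse_fourier F x))\<^sup>2) \<partial>lborel)"
    by (subst nn_integral_cmult[symmetric])
       (auto intro!: nn_integral_cong simp: inverse_fourier_def fourier_def mult.commute ennreal_mult'[symmetric] norm_divide power_divide)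
  finally have "(\<integral>\<^sup>+x. ennreal ((cmod (inverse_fourier F x))\<^sup>2) \<partial>lborel)
      = ennreal (1 / (2 * pi)\<^sup>2) * (\<integral>\<^sup>+x. ennreal ((cmod (fourier F x))\<^sup>2) \<partial>lborel)" by simp
  also have "\<dots> \<le> ennreal (1 / (2 * pi)\<^sup>2) * (ennreal (2 * pi) * (\<integral>\<^sup>+t. ennreal ((cmod (F t))\<^sup>2) \<partial>lborel))"
    by (intro mult_left_mono bessel_fourier[OF F]) simp
  also have "\<dots> = ennreal (1 / (2 * pi)\<^sup>2 * (2 * pi)) * (\<integral>\<^sup>+t. ennreal ((cmod (F t))\<^sup>2) \<partial>lborel)"
    by (simp only: ennreal_mult mult.assoc pi_ge_zero zero_le_numeral mult_nonneg_nonneg zero_le_divide_1_iff zero_le_power2)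
  also have "1 / (2 * pi)\<^sup>2 * (2 * pi) = 1 / (2 * pi)" by (simp add: power2_eq_square)
  finally show ?thesis .
qed

section \<open>Inversion of integrable characteristic functions\<close>

text \<open>The weight in Levy's inversion formula is the Fourier integral of an interval; this is what
  lets the formula for the mass of an interval be read as an integral of a density.\<close>

lemma iexp_integral_interval:
  fixes a b t :: real
  assumes "a \<le> b" "t \<noteq> 0"
  shows "(CLINT x|lborel. indicator {a<..b} x *\<^sub>R iexp (- (t * x)))
     = (iexp (- (t * a)) - iexp (- (t * b))) / (\<i> * t)"
proof -
  have "(CLINT x|lborel. indicator {a..b} x *\<^sub>R iexp (- (t * x)))
     = (\<i> / t * iexp (- (t * b))) - (\<i> / t * iexp (- (t * a)))"
  proof (rule integral_FTC_Icc)
    have E: "\<i> / t * (E * (\<i> * - complex_of_real t)) = E" for E :: complex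
    proof -
      have "\<i> / t * (E * (\<i> * - complex_of_real t)) = - (\<i> * \<i>) * E"
        using assms(2) by (simp add: field_simps del: i_squared)
      then show ?thesis by simp
    qed
    fix x :: real
    have "((\<lambda>z. \<i> / t * exp (\<i> * - (t * z))) has_field_derivative \<i> / t * (exp (\<i> * - (t * complex_of_real x)) * (\<i> * - t)))
       (at (complex_of_real x))"
      using assms(2) by (auto intro!: derivative_eq_intros simp: mult.commute[of "exp z" "\<i>" for z])
    from has_vector_derivative_real_field[OF this, of "{a..b}"]
    show "((\<lambda>x. \<i> / t * iexp (- (t * x))) has_vector_derivative iexp (- (t * x))) (at x within {a..b})"
      by (simp only: E of_real_minus of_real_mult)
  next
    show "continuous_on {a..b} (\<lambda>x. iexp (- (t * x)))"
      by (intro continuous_intros)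
  qed (use assms in simp)
  moreover have "(CLINT x|lborel. indicator {a..b} x *\<^sub>R iexp (- (t * x))) =
     (CLINT x|lborel. indicator {a<..b} x *\<^sub>R iexp (- (t * x)))"
    by (rule integral_cong_AE) (use AE_lborel_singleton[of a] in \<open>auto simp: indicator_def\<close>)
  moreover have "\<i> / t * B - \<i> / t * A = (A - B) / (\<i> * t)" for A B :: complex
    by (simp add: divide_inverse algebra_simps)
  ultimately show ?thesis by simp
qed

context
  fixes \<mu> :: "real measure"
  assumes real_dist: "real_distribution \<mu>"
    and char_int: "integrable lborel (char \<mu>)"
begin

interpretation real_distribution \<mu> by (rule real_dist)

text \<open>Continuity turns information on integrals over intervals into
  pointwise information.\<close>

lemma isCont_inverse_char: "isCont (inverse_fourier (char \<mu>)) x"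
proof -
  have "(\<lambda>n. CLINT t|lborel. char \<mu> t * iexp (- (t * X n))) \<longlonglongrightarrow> (CLINT t|lborel. char \<mu> t * iexp (- (t * x)))"
    if "X \<longlonglongrightarrow> x" for X
    by (rule integral_dominated_convergence[where w = "\<lambda>t. cmod (char \<mu> t)"])
       (use char_int that in \<open>auto simp: norm_mult intro!: tendsto_intros\<close>)
  then show ?thesis
    unfolding continuous_at_sequentially inverse_fourier_def comp_def
    by (auto intro!: tendsto_intros)
qed

text \<open>For an integrable characteristic function the truncated integrals in Levy's formula converge
  absolutely, and Fubini's theorem moves the integral over the interval to the outside.\<close>

lemma measure_interval_inverse_char:
  assumes "a \<le> b" "measure \<mu> {a} = 0" "measure \<mu> {b} = 0"
  shows "complex_of_real (measure \<mu> {a<..b}) = (CLINT x|lborel. indicator {a<..b} x *\<^sub>R inverse_fourier (char \<mu>) x)"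
proof -
  have Levy: "(\<lambda>T::nat. 1 / (2 * pi) * (CLBINT t=-T..T. (iexp (-(t * a)) - iexp (-(t * b))) / (\<i> * t) * char \<mu> t))
    \<longlonglongrightarrow> complex_of_real (measure \<mu> {a<..b})"
    by (rule Levy_Inversion[OF assms])
  let ?k = "\<lambda>t. CLINT x|lborel. indicator {a<..b} x *\<^sub>R iexp (- (t * x))"
  have ind_int: "integrable lborel (\<lambda>x. indicator {a<..b} x :: real)"
    using assms(1) by (intro integrable_real_indicator) auto
  have [measurable]: "?k \<in> borel_measurable borel" by measurable
  have k_bound: "cmod (?k t) \<le> b - a" for t
  proof -
    have "cmod (?k t) \<le> (LINT x|lborel. cmod (indicator {a<..b} x *\<^sub>R iexp (- (t * x))))"
      by (rule integral_norm_bound)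
    also have "\<dots> = (LINT x|lborel. indicator {a<..b} x)" by simp
    also have "\<dots> = b - a" using assms(1) by simp
    finally show ?thesis .
  qed
  have int_k: "integrable lborel (\<lambda>t. ?k t * char \<mu> t)"
  proof (rule Bochner_Integration.integrable_bound[where f = "\<lambda>t. (b - a) *\<^sub>R char \<mu> t"])
    show "AE t in lborel. cmod (?k t * char \<mu> t) \<le> cmod ((b - a) *\<^sub>R char \<mu> t)"
      using k_bound assms(1) by (simp add: norm_mult mult_right_mono)
  qed (use char_int in simp_all)
  have lim: "(\<lambda>T::nat. CLINT t|lborel. indicator {-real T<..<real T} t *\<^sub>R (?k t * char \<mu> t))
    \<longlonglongrightarrow> (CLINT t|lborel. ?k t * char \<mu> t)"
  proof (rule integral_dominated_convergence[where w = "\<lambda>t. cmod (?k t * char \<mu> t)"])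
    show "AE t in lborel. (\<lambda>T::nat. indicator {-real T<..<real T} t *\<^sub>R (?k t * char \<mu> t)) \<longlonglongrightarrow> ?k t * char \<mu> t"
    proof (intro AE_I2 tendsto_eventually)
      fix t :: real
      show "\<forall>\<^sub>F T::nat in sequentially. indicator {-real T<..<real T} t *\<^sub>R (?k t * char \<mu> t) = ?k t * char \<mu> t"
        using eventually_gt_at_top[of "nat \<lceil>\<bar>t\<bar>\<rceil>"]
      proof eventually_elim
        case (elim T)
        then have "\<bar>t\<bar> < real T" by linarith
        then show ?case by (simp add: indicator_def abs_less_iff)
      qed
    qed
  qed (use int_k integrable_norm[OF int_k] in \<open>auto simp: indicator_def\<close>)
  have eq: "(CLBINT t=-T..T. (iexp (-(t * a)) - iexp (-(t * b))) / (\<i> * t) * char \<mu> t)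
     = (CLINT t|lborel. indicator {-real T<..<real T} t *\<^sub>R (?k t * char \<mu> t))" for T :: nat
  proof -
    have "(CLBINT t=-T..T. (iexp (-(t * a)) - iexp (-(t * b))) / (\<i> * t) * char \<mu> t)
       = (CLINT t|lborel. indicator {-real T<..<real T} t *\<^sub>R ((iexp (-(t * a)) - iexp (-(t * b))) / (\<i> * t) * char \<mu> t))"
      by (simp add: interval_lebesgue_integral_def set_lebesgue_integral_def)
    also have "\<dots> = (CLINT t|lborel. indicator {-real T<..<real T} t *\<^sub>R (?k t * char \<mu> t))"
    proof (rule integral_cong_AE)
      show "AE t in lborel. indicator {-real T<..<real T} t *\<^sub>R ((iexp (-(t * a)) - iexp (-(t * b))) / (\<i> * t) * char \<mu> t)
          = indicator {-real T<..<real T} t *\<^sub>R (?k t * char \<mu> t)"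
        using AE_lborel_singleton[of 0]
      proof eventually_elim
        case (elim t)
        show ?case by (simp only: iexp_integral_interval[OF assms(1) elim])
      qed
    qed measurable
    finally show ?thesis .
  qed
  have joint: "integrable (lborel \<Otimes>\<^sub>M lborel)
     (\<lambda>(t, x). indicator {a<..b} x *\<^sub>R (char \<mu> t * iexp (- (t * x))))"
  proof (rule Bochner_Integration.integrable_bound)
    show "integrable (lborel \<Otimes>\<^sub>M lborel) (\<lambda>(t, x). char \<mu> t * complex_of_real (indicator {a<..b} x))"
      using char_int ind_int by (intro integrable_tensor) (simp_all only: complex_of_real_integrable_eq)
  qed (auto simp: norm_mult)
  have "(CLINT t|lborel. ?k t * char \<mu> t)
      = (CLINT t|lborel. CLINT x|lborel. indicator {a<..b} x *\<^sub>R (char \<mu> t * iexp (- (t * x))))"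
    by (simp only: integral_mult_left_zero[symmetric]) (simp add: mult.commute)
  also have "\<dots> = (CLINT x|lborel. CLINT t|lborel. indicator {a<..b} x *\<^sub>R (char \<mu> t * iexp (- (t * x))))"
    by (rule lborel_pair.Fubini_integral[OF joint, symmetric])
  also have "\<dots> = (CLINT x|lborel. indicator {a<..b} x *\<^sub>R (CLINT t|lborel. char \<mu> t * iexp (- (t * x))))"
    by (simp only: integral_scaleR_right)
  also have "1 / (2 * pi) * \<dots> = (CLINT x|lborel. indicator {a<..b} x *\<^sub>R inverse_fourier (char \<mu>) x)"
    unfolding inverse_fourier_def by (simp flip: integral_mult_right_zero add: mult_scaleR_right)
  finally have *: "1 / (2 * pi) * (CLINT t|lborel. ?k t * char \<mu> t) = (CLINT x|lborel. indicator {a<..b} x *\<^sub>R inverse_fourier (char \<mu>) x)" .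
  have "(\<lambda>T::nat. 1 / (2 * pi) * (CLINT t|lborel. indicator {-real T<..<real T} t *\<^sub>R (?k t * char \<mu> t)))
    \<longlonglongrightarrow> 1 / (2 * pi) * (CLINT t|lborel. ?k t * char \<mu> t)"
    by (intro tendsto_mult_left lim)
  then show ?thesis
    using Levy unfolding eq * by (rule LIMSEQ_unique[rotated])
qed


text \<open>By the preceding lemma the complex function \<open>inverse_fourier (char \<mu>)\<close> has the masses
  \<open>\<mu> {a<..b}\<close> as its integrals. Being continuous, it is therefore real and nonnegative
  everywhere, hence the density of a measure that agrees with \<open>\<mu>\<close> on intervals, and densities
  are unique almost everywhere.\<close>

lemma inverse_char_density:
  assumes [measurable]: "f \<in> borel_measurable borel" and "\<And>x. 0 \<le> f x" and \<mu>: "\<mu> = density lborel (\<lambda>x. ennreal (f x))"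
  shows "AE x in lborel. complex_of_real (f x) = inverse_fourier (char \<mu>) x"
proof -
  have "emeasure \<mu> {a} = 0" for a :: real
    unfolding \<mu> using AE_lborel_singleton[of a]
    by (auto simp: emeasure_density nn_integral_0_iff_AE indicator_def)
  then have null: "measure \<mu> {a} = 0" for a :: real
    by (simp add: measure_def)
  note int = measure_interval_inverse_char[OF _ null null]
  let ?g = "\<lambda>x. Re (inverse_fourier (char \<mu>) x)"
  have cont: "continuous_on A (inverse_fourier (char \<mu>))" for A
    using isCont_inverse_char by (simp add: continuous_at_imp_continuous_on)
  have cont_Re: "continuous_on A ?g" and cont_Im: "continuous_on A (\<lambda>x. Im (inverse_fourier (char \<mu>) x))" for A
    by (intro continuous_intros cont)+
  have [measurable]: "inverse_fourier (char \<mu>) \<in> borel_measurable borel"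
    by (intro borel_measurable_continuous_onI cont)
  have set_int: "integrable lborel (\<lambda>x. indicator {a<..b} x *\<^sub>R inverse_fourier (char \<mu>) x)" for a b
  proof -
    have "integrable lborel (\<lambda>x. indicator {a..b} x *\<^sub>R inverse_fourier (char \<mu>) x)"
      by (rule borel_integrable_compact[OF compact_Icc cont])
    then show ?thesis
      by (rule Bochner_Integration.integrable_bound) (auto simp: indicator_def)
  qed
  have Re_int: "measure \<mu> {a<..b} = (LINT x|lborel. indicator {a<..b} x *\<^sub>R ?g x)"
    and Im_int: "0 = (LINT x|lborel. indicator {a<..b} x *\<^sub>R Im (inverse_fourier (char \<mu>) x))" if "a \<le> b" for a b
    using arg_cong[OF int[OF that], of Re] arg_cong[OF int[OF that], of Im] set_int[of a b]
    by (simp_all flip: integral_Re integral_Im)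
  \<comment> \<open>A continuous function that is negative at a point has a negative integral nearby.\<close>
  have sign: "0 \<le> r x" if r: "continuous_on UNIV r"
     and "\<And>a b. a \<le> b \<Longrightarrow> 0 \<le> (LINT x|lborel. indicator {a<..b} x *\<^sub>R r x)" for r :: "real \<Rightarrow> real" and x
  proof (rule ccontr)
    assume neg: "\<not> 0 \<le> r x"
    have "isCont r x" using r by (simp add: continuous_on_eq_continuous_at)
    then have "\<forall>\<^sub>F y in at x. r y < r x / 2"
      using neg by (intro order_tendstoD(2)[of r "r x"]) (auto simp: isCont_def)
    then obtain d where d: "d > 0" "\<And>y. y \<noteq> x \<Longrightarrow> \<bar>y - x\<bar> < d \<Longrightarrow> r y < r x / 2"
      by (auto simp: eventually_at dist_real_def)
    let ?b = "x + d / 2"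
    have "(LINT y|lborel. indicator {x<..?b} y *\<^sub>R r y) \<le> (LINT y|lborel. indicator {x<..?b} y *\<^sub>R (r x / 2))"
    proof (rule integral_mono)
      have r_int: "integrable lborel (\<lambda>y. indicator {x..?b} y *\<^sub>R r y)"
        by (rule borel_integrable_compact[OF compact_Icc continuous_on_subset[OF r]]) simp
      have [measurable]: "r \<in> borel_measurable borel"
        by (intro borel_measurable_continuous_onI r)
      show "integrable lborel (\<lambda>y. indicator {x<..?b} y *\<^sub>R r y)"
        by (rule Bochner_Integration.integrable_bound[OF r_int]) (auto simp: indicator_def)
      show "integrable lborel (\<lambda>y. indicator {x<..?b} y *\<^sub>R (r x / 2))"
        using d(1) by (intro integrable_scaleR_left integrable_real_indicator) auto
    qed (use d in \<open>force simp: indicator_def abs_if\<close>)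
    also have "\<dots> = d / 2 * (r x / 2)" using d(1) by simp
    also have "\<dots> < 0" using d(1) neg by (simp add: mult_less_0_iff)
    finally show False using that(2)[of x ?b] d(1) by simp
  qed
  have Im0: "Im (inverse_fourier (char \<mu>) x) = 0" for x
  proof (rule antisym)
    show "0 \<le> Im (inverse_fourier (char \<mu>) x)"
      by (rule sign[OF cont_Im]) (simp only: Im_int[symmetric])
    have "0 \<le> - Im (inverse_fourier (char \<mu>) x)"
    proof (rule sign[OF continuous_on_minus[OF cont_Im]])
      fix a b :: real assume "a \<le> b"
      then show "0 \<le> (LINT x|lborel. indicator {a<..b} x *\<^sub>R - Im (inverse_fourier (char \<mu>) x))"
        using Im_int[of a b] by simp
    qed
    then show "Im (inverse_fourier (char \<mu>) x) \<le> 0" by simp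
  qed
  have g_nonneg: "0 \<le> ?g x" for x
  proof (rule sign[OF cont_Re])
    fix a b :: real assume "a \<le> b"
    then show "0 \<le> (LINT x|lborel. indicator {a<..b} x *\<^sub>R ?g x)"
      using Re_int[of a b] measure_nonneg[of \<mu> "{a<..b}"] by simp
  qed
  have eq: "emeasure \<mu> {a<..b} = emeasure (density lborel (\<lambda>x. ennreal (?g x))) {a<..b}" for a b
  proof (cases "a \<le> b")
    case True
    have "emeasure (density lborel (\<lambda>x. ennreal (?g x))) {a<..b} = (\<integral>\<^sup>+x. ennreal (indicator {a<..b} x *\<^sub>R ?g x) \<partial>lborel)"
      by (subst emeasure_density) (auto intro!: nn_integral_cong simp: indicator_def)
    also have "\<dots> = ennreal (LINT x|lborel. indicator {a<..b} x *\<^sub>R ?g x)"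
      using integrable_Re[OF set_int[of a b]] g_nonneg by (intro nn_integral_eq_integral) auto
    finally show ?thesis by (simp only: Re_int[OF True] emeasure_eq_measure)
  qed simp
  have "\<mu> = density lborel (\<lambda>x. ennreal (?g x))"
  proof (rule measure_eqI_generator_eq[where \<Omega> = UNIV])
    fix X assume "X \<in> range (\<lambda>(a, b). {a<..b::real})"
    then show "emeasure \<mu> X = emeasure (density lborel (\<lambda>x. ennreal (?g x))) X"
      using eq by auto
  next
    show "(\<Union>i. {- real (i::nat)<..real i}) = UNIV"
      by (rule UN_Ioc_eq_UNIV)
  qed (auto simp: emeasure_eq_measure borel_sigma_sets_Ioc Int_stable_def)
  then have "density lborel (\<lambda>x. ennreal (f x)) = density lborel (\<lambda>x. ennreal (?g x))"
    using \<mu> by simp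
  then have "AE x in lborel. ennreal (f x) = ennreal (?g x)"
    by (subst (asm) sigma_finite_measure.density_unique_iff[OF sigma_finite_lborel]) auto
  then show ?thesis
    by eventually_elim (use assms(2) g_nonneg Im0 in \<open>auto simp: complex_eq_iff\<close>)
qed

end

section \<open>Characteristic functions of densities near the origin\<close>

text \<open>The Taylor expansion of order three leaves an error of at most \<open>y ^ 4 / 24\<close>, which on
  \<open>[-1, 1]\<close> is small compared with the quadratic term.\<close>

lemma one_minus_cos_ge:
  fixes y :: real
  assumes "\<bar>y\<bar> \<le> 1"
  shows "y\<^sup>2 / 4 \<le> 1 - cos y"
proof -
  have "cmod (iexp y - (\<Sum>k\<le>3. (\<i> * y) ^ k / fact k)) \<le> \<bar>y\<bar> ^ 4 / 24"
    using iexp_approx1[of y 3] by (simp add: fact_numeral)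
  then have "\<bar>Re (iexp y - (\<Sum>k\<le>3. (\<i> * y) ^ k / fact k))\<bar> \<le> \<bar>y\<bar> ^ 4 / 24"
    using abs_Re_le_cmod order_trans by blast
  moreover have "Re (\<Sum>k\<le>3. (\<i> * y) ^ k / fact k) = 1 - y\<^sup>2 / 2"
    by (simp add: numeral_3_eq_3 numeral_2_eq_2 fact_numeral)
  moreover have "\<bar>y\<bar> ^ 4 \<le> y\<^sup>2"
  proof -
    have "y\<^sup>2 * y\<^sup>2 \<le> y\<^sup>2 * 1" using assms by (intro mult_left_mono) (simp_all add: abs_square_le_1)
    then show ?thesis by (simp add: power_numeral_reduce power2_eq_square mult.assoc)
  qed
  ultimately have "\<bar>cos y - (1 - y\<^sup>2 / 2)\<bar> \<le> y\<^sup>2 / 24"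
    by (simp add: Re_exp del: Re_sum)
  then have "cos y - (1 - y\<^sup>2 / 2) \<le> y\<^sup>2 / 24" by (rule order_trans[OF abs_ge_self])
  then show ?thesis using zero_le_power2[of y] by linarith
qed

text \<open>This is where kernels that are densities are limited: \<open>1 - char\<close> cannot vanish to higher than
  second order at the origin, since the real part is the mean of \<open>1 - cos (u * x)\<close>, which is
  nonnegative and at least \<open>(u * x)\<^sup>2 / 4\<close> on a bounded range of \<open>x\<close>. Cutting \<open>x\<close> off at a
  fixed radius \<open>R\<close> covers densities of infinite variance; \<open>R\<close> has to be so large that
  the law has mass in \<open>[-R, R]\<close> away from the origin.\<close>

lemma one_minus_char_ge_square:
  assumes "prob_density K"
  obtains c \<delta> where "c > 0" "\<delta> > 0"
    "\<And>u. \<bar>u\<bar> \<le> \<delta> \<Longrightarrow> c * u\<^sup>2 \<le> cmod (1 - char (density lborel (\<lambda>x. ennreal (K x))) u)"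
proof -
  define \<nu> where "\<nu> = density lborel (\<lambda>x. ennreal (K x))"
  have [measurable]: "K \<in> borel_measurable borel" and K0: "\<And>x. 0 \<le> K x" and K1: "(\<integral>\<^sup>+x. ennreal (K x) \<partial>lborel) = 1"
    using assms by (auto simp: prob_density_def)
  interpret prob_space \<nu>
    by (rule prob_spaceI) (simp add: \<nu>_def emeasure_density K1)
  have [measurable_cong, simp]: "sets \<nu> = sets borel" by (simp add: \<nu>_def)
  let ?I = "\<lambda>R. LINT x|\<nu>. indicator {-R..R} x * x\<^sup>2"
  have int: "integrable \<nu> (\<lambda>x. indicator {-R..R} x * x\<^sup>2)" for R :: real
  proof (rule integrable_const_bound[where B = "R\<^sup>2"])
    show "AE x in \<nu>. norm (indicator {-R..R} x * x\<^sup>2) \<le> R\<^sup>2"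
      by (auto simp: indicator_def abs_le_square_iff[symmetric])
  qed simp
  obtain n :: nat where n: "?I (real n) > 0"
  proof (rule ccontr)
    assume "\<not> thesis"
    have "?I (real n) = 0" for n
    proof (rule antisym)
      show "?I (real n) \<le> 0" using that[of n] \<open>\<not> thesis\<close> by (meson not_le)
      show "0 \<le> ?I (real n)" by (intro Bochner_Integration.integral_nonneg) auto
    qed
    then have "AE x in \<nu>. indicator {-real n..real n} x * x\<^sup>2 = 0" for n
      by (subst (asm) integral_nonneg_eq_0_iff_AE[OF int]) auto
    then have "AE x in \<nu>. \<forall>n. indicator {-real n..real n} x * x\<^sup>2 = 0"
      by (subst AE_all_countable) blast
    then have "AE x in \<nu>. x = 0"
    proof eventually_elim
      case (elim x)
      obtain n where "\<bar>x\<bar> \<le> real n" using real_arch_simple by blast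
      with elim[rule_format, of n] show ?case by (auto simp: indicator_def abs_le_iff split: if_splits)
    qed
    then have "AE x in lborel. K x > 0 \<longrightarrow> x = 0"
      unfolding \<nu>_def by (simp add: AE_density)
    with AE_lborel_singleton[of 0] have "AE x in lborel. ennreal (K x) = 0"
      by eventually_elim (use K0 in \<open>force simp: less_le\<close>)
    then have "(\<integral>\<^sup>+x. ennreal (K x) \<partial>lborel) = 0" by (simp add: nn_integral_0_iff_AE)
    then show False using K1 by simp
  qed
  \<comment> \<open>Adding 1 keeps the radius positive, so that it can be inverted.\<close>
  define R where "R = real n + 1"
  have "?I (real n) \<le> ?I R"
    by (intro integral_mono int) (auto simp: R_def indicator_def)
  then have IR: "?I R > 0" using n by simp
  have "R > 0" by (simp add: R_def)
  show thesis
  proof (rule that)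
    show "?I R / 4 > 0" "1 / R > 0" using IR \<open>R > 0\<close> by auto
    fix u :: real assume u: "\<bar>u\<bar> \<le> 1 / R"
    have int1: "integrable \<nu> (\<lambda>x. iexp (u * x))" by (intro integrable_const_bound[where B = 1]) auto
    have int2: "integrable \<nu> (\<lambda>x. 1 - cos (u * x))"
      by (intro integrable_const_bound[where B = 2]) (auto intro: order_trans[OF norm_triangle_ineq4] simp: abs_cos_le_one intro!: order_trans[OF abs_triangle_ineq4])
    have "?I R / 4 * u\<^sup>2 = (LINT x|\<nu>. u\<^sup>2 / 4 * (indicator {-R..R} x * x\<^sup>2))" by simp
    also have "\<dots> \<le> (LINT x|\<nu>. 1 - cos (u * x))"
    proof (intro integral_mono integrable_mult_right int int2)
      fix x :: real
      show "u\<^sup>2 / 4 * (indicator {-R..R} x * x\<^sup>2) \<le> 1 - cos (u * x)"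
      proof (cases "\<bar>x\<bar> \<le> R")
        case True
        have "\<bar>u * x\<bar> \<le> 1 / R * R" unfolding abs_mult using True u \<open>R > 0\<close> by (intro mult_mono) auto
        then have "(u * x)\<^sup>2 / 4 \<le> 1 - cos (u * x)" using \<open>R > 0\<close> by (intro one_minus_cos_ge) simp
        then show ?thesis using True by (auto simp: indicator_def abs_le_iff power_mult_distrib)
      next
        case False
        then show ?thesis by (auto simp: indicator_def)
      qed
    qed
    also have "\<dots> = Re (1 - char \<nu> u)"
    proof -
      have "Re (char \<nu> u) = (LINT x|\<nu>. Re (iexp (u * x)))"
        unfolding char_def by (rule integral_Re[OF int1, symmetric])
      moreover have "integrable \<nu> (\<lambda>x. cos (u * x))"
        by (intro integrable_const_bound[where B = 1]) auto
      ultimately show ?thesis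
        by (simp add: Re_exp prob_space)
    qed
    also have "\<dots> \<le> cmod (1 - char \<nu> u)" by (rule complex_Re_le_cmod)
    finally show "?I R / 4 * u\<^sup>2 \<le> cmod (1 - char (density lborel (\<lambda>x. ennreal (K x))) u)"
      by (simp add: \<nu>_def)
  qed
qed

section \<open>Smoothing by a probability law\<close>

text \<open>The convolution of \<open>q\<close> with the law \<open>\<mu>\<close>. It occurs with the law of the sample in the role of
  \<open>\<mu>\<close> and a kernel as \<open>q\<close>, when it is the mean of the estimator, and also with these two
  roles exchanged.\<close>

definition smoothing :: "real measure \<Rightarrow> (real \<Rightarrow> real) \<Rightarrow> real \<Rightarrow> real" where
  "smoothing \<mu> q x = (LINT y|\<mu>. q (x - y))"

context real_distribution
begin

lemma smoothing_measurable [measurable]: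
  assumes [measurable]: "q \<in> borel_measurable borel"
  shows "smoothing M q \<in> borel_measurable borel"
  unfolding smoothing_def by measurable

text \<open>Lebesgue measure is translation invariant, so averaging over random translates does not change
  an integral.\<close>

lemma nn_integral_translates:
  fixes g :: "real \<Rightarrow> ennreal"
  assumes [measurable]: "g \<in> borel_measurable borel"
  shows "(\<integral>\<^sup>+x. \<integral>\<^sup>+y. g (x - y) \<partial>M \<partial>lborel) = (\<integral>\<^sup>+x. g x \<partial>lborel)"
proof -
  interpret P: pair_sigma_finite lborel M ..
  have "(\<integral>\<^sup>+x. g (x - y) \<partial>lborel) = (\<integral>\<^sup>+x. g x \<partial>lborel)" for y
    using nn_integral_real_affine[of g 1 "- y"] by simp
  moreover have "(\<integral>\<^sup>+x. \<integral>\<^sup>+y. g (x - y) \<partial>M \<partial>lborel) = (\<integral>\<^sup>+y. \<integral>\<^sup>+x. g (x - y) \<partial>lborel \<partial>M)"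
    by (rule P.Fubini'[symmetric]) measurable
  ultimately show ?thesis by (simp add: emeasure_space_1[simplified])
qed

text \<open>Although \<open>q\<close> may be unbounded and the law arbitrary, the second moment of \<open>q (x - Y)\<close> with
  \<open>Y\<close> distributed as \<open>M\<close> exists for almost every \<open>x\<close>.\<close>

lemma
  assumes q: "square_integrable q"
  shows AE_square_integrable_translates: "AE x in lborel. integrable M (\<lambda>y. (q (x - y))\<^sup>2)"
    and integrable_second_moment: "integrable lborel (\<lambda>x. LINT y|M. (q (x - y))\<^sup>2)"
    and integral_second_moment: "(LINT x|lborel. LINT y|M. (q (x - y))\<^sup>2) = (LINT x|lborel. (q x)\<^sup>2)"
proof -
  have [measurable]: "q \<in> borel_measurable borel" and int: "integrable lborel (\<lambda>x. (q x)\<^sup>2)"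
    using q by (auto simp: square_integrable_def)
  have fin: "(\<integral>\<^sup>+x. ennreal ((q x)\<^sup>2) \<partial>lborel) = ennreal (LINT x|lborel. (q x)\<^sup>2)"
    by (rule nn_integral_eq_integral[OF int]) simp
  have trans: "(\<integral>\<^sup>+x. \<integral>\<^sup>+y. ennreal ((q (x - y))\<^sup>2) \<partial>M \<partial>lborel) = ennreal (LINT x|lborel. (q x)\<^sup>2)"
    by (subst nn_integral_translates) (auto simp: fin)
  have "AE x in lborel. (\<integral>\<^sup>+y. ennreal ((q (x - y))\<^sup>2) \<partial>M) \<noteq> \<infinity>"
    by (rule nn_integral_PInf_AE) (use trans in simp_all)
  then show AE: "AE x in lborel. integrable M (\<lambda>y. (q (x - y))\<^sup>2)"
    by eventually_elim (auto simp: integrable_iff_bounded less_top)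
  have eq: "AE x in lborel. (\<integral>\<^sup>+y. ennreal ((q (x - y))\<^sup>2) \<partial>M) = ennreal (LINT y|M. (q (x - y))\<^sup>2)"
    using AE by eventually_elim (auto intro!: nn_integral_eq_integral)
  have "(\<integral>\<^sup>+x. ennreal (LINT y|M. (q (x - y))\<^sup>2) \<partial>lborel) = ennreal (LINT x|lborel. (q x)\<^sup>2)"
    unfolding trans[symmetric] by (rule nn_integral_cong_AE) (use eq in auto)
  then have "has_bochner_integral lborel (\<lambda>x. LINT y|M. (q (x - y))\<^sup>2) (LINT x|lborel. (q x)\<^sup>2)"
    by (intro has_bochner_integral_nn_integral) auto
  then show "integrable lborel (\<lambda>x. LINT y|M. (q (x - y))\<^sup>2)"
    "(LINT x|lborel. LINT y|M. (q (x - y))\<^sup>2) = (LINT x|lborel. (q x)\<^sup>2)"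
    by (auto simp: has_bochner_integral_iff)
qed

text \<open>The difference of the two sides is the variance of \<open>q (x - Y)\<close>.\<close>

lemma smoothing_square_le:
  assumes "q \<in> borel_measurable borel" "integrable M (\<lambda>y. (q (x - y))\<^sup>2)"
  shows "(smoothing M q x)\<^sup>2 \<le> (LINT y|M. (q (x - y))\<^sup>2)"
proof -
  have [measurable]: "q \<in> borel_measurable borel" by fact
  have "integrable M (\<lambda>y. q (x - y))"
    by (rule square_integrable_imp_integrable[OF _ assms(2)]) measurable
  then show ?thesis
    using variance_eq[of "\<lambda>y. q (x - y)"] variance_positive[of "\<lambda>y. q (x - y)"] assms(2)
    by (simp add: smoothing_def)
qed

text \<open>Integrating the pointwise bound: smoothing is a contraction of the square integrable functions.\<close>

lemma
  assumes q: "square_integrable q"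
  shows square_integrable_smoothing: "square_integrable (smoothing M q)"
    and smoothing_L2_le: "(LINT x|lborel. (smoothing M q x)\<^sup>2) \<le> (LINT x|lborel. (q x)\<^sup>2)"
proof -
  have [measurable]: "q \<in> borel_measurable borel" using q by (auto simp: square_integrable_def)
  have le: "AE x in lborel. (smoothing M q x)\<^sup>2 \<le> (LINT y|M. (q (x - y))\<^sup>2)"
    using AE_square_integrable_translates[OF q] by eventually_elim (rule smoothing_square_le, auto)
  have int: "integrable lborel (\<lambda>x. (smoothing M q x)\<^sup>2)"
    by (rule Bochner_Integration.integrable_bound[OF integrable_second_moment[OF q]])
       (use le in \<open>auto simp: Bochner_Integration.integral_nonneg\<close>)
  then show "square_integrable (smoothing M q)" by (simp add: square_integrable_def)
  show "(LINT x|lborel. (smoothing M q x)\<^sup>2) \<le> (LINT x|lborel. (q x)\<^sup>2)"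
    unfolding integral_second_moment[OF q, symmetric]
    by (rule integral_mono_AE[OF int integrable_second_moment[OF q] le])
qed

end

text \<open>Squared bias plus variance: after centring, independence removes all off-diagonal terms from
  the double sum over pairs of observations.\<close>

lemma (in prob_space) mean_square_error_sample_mean:
  fixes Y :: "nat \<Rightarrow> 'a \<Rightarrow> real"
  assumes indep: "indep_vars (\<lambda>_. borel) Y {1..n}" and "n > 0"
    and sq: "\<And>j. j \<in> {1..n} \<Longrightarrow> integrable M (\<lambda>\<omega>. (Y j \<omega>)\<^sup>2)"
    and mean: "\<And>j. j \<in> {1..n} \<Longrightarrow> expectation (Y j) = m"
    and second: "\<And>j. j \<in> {1..n} \<Longrightarrow> expectation (\<lambda>\<omega>. (Y j \<omega>)\<^sup>2) = s"
  shows "integrable M (\<lambda>\<omega>. (1 / n * (\<Sum>j=1..n. Y j \<omega>) - a)\<^sup>2)"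
    and "expectation (\<lambda>\<omega>. (1 / n * (\<Sum>j=1..n. Y j \<omega>) - a)\<^sup>2) = (m - a)\<^sup>2 + (s - m\<^sup>2) / n"
proof -
  have rv [measurable]: "Y j \<in> borel_measurable M" if "j \<in> {1..n}" for j
    using indep that by (auto simp: indep_vars_def)
  have int: "integrable M (Y j)" if "j \<in> {1..n}" for j
    by (rule square_integrable_imp_integrable[OF rv[OF that] sq[OF that]])
  let ?Z = "\<lambda>j \<omega>. Y j \<omega> - m"
  have Zint: "integrable M (?Z j)" and Z0: "expectation (?Z j) = 0" if "j \<in> {1..n}" for j
    using int[OF that] mean[OF that] by (auto simp: prob_space)
  have ZZ: "integrable M (\<lambda>\<omega>. ?Z i \<omega> * ?Z j \<omega>) \<and> expectation (\<lambda>\<omega>. ?Z i \<omega> * ?Z j \<omega>) = (if i = j then s - m\<^sup>2 else 0)"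
    if ij: "i \<in> {1..n}" "j \<in> {1..n}" for i j
  proof (cases "i = j")
    case True
    have e: "(\<lambda>\<omega>. ?Z i \<omega> * ?Z j \<omega>) = (\<lambda>\<omega>. (Y i \<omega>)\<^sup>2 - 2 * m * Y i \<omega> + m\<^sup>2)"
      using True by (auto simp: power2_eq_square algebra_simps)
    show ?thesis unfolding e using True sq[OF ij(1)] int[OF ij(1)] mean[OF ij(1)] second[OF ij(1)]
      by (auto simp: prob_space power2_eq_square)
  next
    case False
    have "indep_vars (\<lambda>_. borel) Y {i, j}" by (rule indep_vars_subset[OF indep]) (use ij in auto)
    then have "indep_vars (\<lambda>_. borel) (\<lambda>k \<omega>. ?Z k \<omega>) {i, j}" by (rule indep_vars_compose2) auto
    from indep_vars_lebesgue_integral[OF _ this] indep_vars_integrable[OF _ this]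
    show ?thesis using Zint[OF ij(1)] Zint[OF ij(2)] Z0[OF ij(1)] False by auto
  qed
  have expand: "(1 / n * (\<Sum>j=1..n. Y j \<omega>) - a)\<^sup>2 = (m - a)\<^sup>2 + 2 * (m - a) / n * (\<Sum>j=1..n. ?Z j \<omega>)
     + 1 / n\<^sup>2 * (\<Sum>i=1..n. \<Sum>j=1..n. ?Z i \<omega> * ?Z j \<omega>)" for \<omega>
  proof -
    have "(\<Sum>j=1..n. Y j \<omega>) = (\<Sum>j=1..n. ?Z j \<omega>) + n * m" by (simp add: sum_subtractf)
    then have "1 / n * (\<Sum>j=1..n. Y j \<omega>) - a = (m - a) + 1 / n * (\<Sum>j=1..n. ?Z j \<omega>)"
      using \<open>n > 0\<close> by (simp add: field_simps)
    then show ?thesis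
      by (simp only: sum_product[symmetric] power2_sum power_mult_distrib power_one_over)
         (simp add: power2_eq_square)
  qed
  have lin: "has_bochner_integral M (\<lambda>\<omega>. \<Sum>j=1..n. ?Z j \<omega>) (\<Sum>j=1..n. 0)"
    using Zint Z0 by (intro has_bochner_integral_sum) (auto simp: has_bochner_integral_iff simp del: Bochner_Integration.integral_diff)
  have quad: "has_bochner_integral M (\<lambda>\<omega>. \<Sum>i=1..n. \<Sum>j=1..n. ?Z i \<omega> * ?Z j \<omega>)
      (\<Sum>i=1..n. \<Sum>j=1..n. if i = j then s - m\<^sup>2 else 0)"
    using ZZ by (intro has_bochner_integral_sum) (auto simp: has_bochner_integral_iff)
  have const: "has_bochner_integral M (\<lambda>\<omega>. (m - a)\<^sup>2) ((m - a)\<^sup>2)"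
    by (simp add: has_bochner_integral_iff prob_space)
  have "has_bochner_integral M (\<lambda>\<omega>. (1 / n * (\<Sum>j=1..n. Y j \<omega>) - a)\<^sup>2)
     ((m - a)\<^sup>2 + 2 * (m - a) / n * (\<Sum>j=1..n. 0) + 1 / n\<^sup>2 * (\<Sum>i=1..n. \<Sum>j=1..n. if i = j then s - m\<^sup>2 else 0))"
    unfolding expand
    by (intro has_bochner_integral_add const has_bochner_integral_mult_right lin quad)
  also have "(m - a)\<^sup>2 + 2 * (m - a) / n * (\<Sum>j=1..n. 0) + 1 / n\<^sup>2 * (\<Sum>i=1..n. \<Sum>j=1..n. if i = j then s - m\<^sup>2 else 0)
     = (m - a)\<^sup>2 + (s - m\<^sup>2) / n"
    using \<open>n > 0\<close> by (simp add: power2_eq_square)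
  finally show "integrable M (\<lambda>\<omega>. (1 / n * (\<Sum>j=1..n. Y j \<omega>) - a)\<^sup>2)"
    and "expectation (\<lambda>\<omega>. (1 / n * (\<Sum>j=1..n. Y j \<omega>) - a)\<^sup>2) = (m - a)\<^sup>2 + (s - m\<^sup>2) / n"
    by (auto simp: has_bochner_integral_iff)
qed

section \<open>Squared bias and variance\<close>

lemma integrable_square_diff:
  assumes "square_integrable a" "square_integrable b"
  shows "integrable lborel (\<lambda>x. (a x - b x)\<^sup>2)"
proof (rule Bochner_Integration.integrable_bound)
  have [measurable]: "a \<in> borel_measurable borel" "b \<in> borel_measurable borel"
    using assms by (auto simp: square_integrable_def)
  show "(\<lambda>x. (a x - b x)\<^sup>2) \<in> borel_measurable lborel" by measurable
  show "integrable lborel (\<lambda>x. 2 * (a x)\<^sup>2 + 2 * (b x)\<^sup>2)"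
    using assms by (auto simp: square_integrable_def)
  have "(u - v)\<^sup>2 \<le> 2 * u\<^sup>2 + 2 * v\<^sup>2" for u v :: real
    using zero_le_power2[of "u + v"] unfolding power2_sum power2_diff by linarith
  then show "AE x in lborel. norm ((a x - b x)\<^sup>2) \<le> norm (2 * (a x)\<^sup>2 + 2 * (b x)\<^sup>2)" by simp
qed

text \<open>Fubini's theorem reduces the risk to the mean square error at a fixed point \<open>x\<close>. There the
  estimator is the mean of \<open>n\<close> independent copies of \<open>q (x - X)\<close>, which have finite variance
  for almost every \<open>x\<close>. Integrating the second moments gives the square integral of \<open>q\<close>, so
  the right-hand side depends on the sample only through its law.\<close>

lemma MISE_sample_average:
  fixes X :: "nat \<Rightarrow> 'a \<Rightarrow> real"
  assumes M: "prob_space M" and indep: "prob_space.indep_vars M (\<lambda>_. borel) X {1..}"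
    and law: "\<And>j. j \<ge> 1 \<Longrightarrow> distr M borel (X j) = \<mu>" and \<mu>: "real_distribution \<mu>"
    and q: "square_integrable q" and f: "square_integrable f" and "n > 0"
  shows "MISE M (\<lambda>\<omega> x. 1 / n * (\<Sum>j=1..n. q (x - X j \<omega>))) f
    = ennreal ((LINT x|lborel. (smoothing \<mu> q x - f x)\<^sup>2)
        + ((LINT x|lborel. (q x)\<^sup>2) - (LINT x|lborel. (smoothing \<mu> q x)\<^sup>2)) / n)"
proof -
  interpret prob_space M by fact
  interpret \<mu>: real_distribution \<mu> by fact
  interpret P: pair_sigma_finite M lborel ..
  have [measurable]: "q \<in> borel_measurable borel" "f \<in> borel_measurable borel"
    using q f by (auto simp: square_integrable_def)
  have X [measurable]: "X j \<in> borel_measurable M" if "j \<ge> 1" for j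
    using indep that by (auto simp: indep_vars_def)
  have expX: "integrable M (\<lambda>\<omega>. g (X j \<omega>)) = integrable \<mu> g" "expectation (\<lambda>\<omega>. g (X j \<omega>)) = (LINT y|\<mu>. g y)"
    if "j \<ge> 1" and [measurable]: "g \<in> borel_measurable borel" for j and g :: "real \<Rightarrow> real"
    using X[OF that(1)] unfolding law[OF that(1), symmetric]
    by (simp_all add: integrable_distr_eq integral_distr)
  let ?est = "\<lambda>\<omega> x. 1 / n * (\<Sum>j=1..n. q (x - X j \<omega>))"
  let ?m = "smoothing \<mu> q" and ?s = "\<lambda>x. LINT y|\<mu>. (q (x - y))\<^sup>2"
  have m_int: "integrable lborel (\<lambda>x. (?m x)\<^sup>2)"
    using \<mu>.square_integrable_smoothing[OF q] by (simp add: square_integrable_def)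
  have s_int: "integrable lborel ?s" by (rule \<mu>.integrable_second_moment[OF q])
  have bias_int: "integrable lborel (\<lambda>x. (?m x - f x)\<^sup>2)"
    by (rule integrable_square_diff[OF \<mu>.square_integrable_smoothing[OF q] f])
  have "(\<lambda>(\<omega>, x). q (x - X j \<omega>)) \<in> borel_measurable (M \<Otimes>\<^sub>M lborel)" if "j \<in> {1..n}" for j
  proof -
    have [measurable]: "X j \<in> borel_measurable M" using X that by simp
    show ?thesis by measurable
  qed
  then have [measurable]: "(\<lambda>(\<omega>, x). ?est \<omega> x) \<in> borel_measurable (M \<Otimes>\<^sub>M lborel)"
    unfolding case_prod_beta by (intro borel_measurable_times borel_measurable_sum) auto
  have "MISE M ?est f = (\<integral>\<^sup>+x. \<integral>\<^sup>+\<omega>. ennreal ((?est \<omega> x - f x)\<^sup>2) \<partial>M \<partial>lborel)"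
    unfolding MISE_def by (rule P.Fubini'[symmetric]) measurable
  also have "\<dots> = (\<integral>\<^sup>+x. ennreal ((?m x - f x)\<^sup>2 + (?s x - (?m x)\<^sup>2) / n) \<partial>lborel)"
  proof (rule nn_integral_cong_AE, use \<mu>.AE_square_integrable_translates[OF q] in eventually_elim)
    case (elim x)
    have Yindep: "indep_vars (\<lambda>_. borel) (\<lambda>j \<omega>. q (x - X j \<omega>)) {1..n}"
      by (rule indep_vars_compose2[OF indep_vars_subset[OF indep]]) auto
    have sq: "integrable M (\<lambda>\<omega>. (q (x - X j \<omega>))\<^sup>2)" and m: "expectation (\<lambda>\<omega>. q (x - X j \<omega>)) = ?m x"
      and s: "expectation (\<lambda>\<omega>. (q (x - X j \<omega>))\<^sup>2) = ?s x" if "j \<in> {1..n}" for j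
      using expX[of j "\<lambda>y. (q (x - y))\<^sup>2"] expX[of j "\<lambda>y. q (x - y)"] elim that
      by (simp_all add: smoothing_def)
    note mse = mean_square_error_sample_mean[OF Yindep \<open>n > 0\<close> sq m s, of "f x"]
    have "(\<integral>\<^sup>+\<omega>. ennreal ((?est \<omega> x - f x)\<^sup>2) \<partial>M) = ennreal (expectation (\<lambda>\<omega>. (?est \<omega> x - f x)\<^sup>2))"
      by (rule nn_integral_eq_integral[OF mse(1)]) auto
    then show ?case by (simp only: mse(2))
  qed
  also have "\<dots> = ennreal (LINT x|lborel. (?m x - f x)\<^sup>2 + (?s x - (?m x)\<^sup>2) / n)"
  proof (rule nn_integral_eq_integral)
    show "AE x in lborel. 0 \<le> (?m x - f x)\<^sup>2 + (?s x - (?m x)\<^sup>2) / n"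
      using \<mu>.AE_square_integrable_translates[OF q]
      by eventually_elim (use \<mu>.smoothing_square_le[of q] in auto)
    show "integrable lborel (\<lambda>x. (?m x - f x)\<^sup>2 + (?s x - (?m x)\<^sup>2) / n)"
      by (intro Bochner_Integration.integrable_add integrable_divide_zero Bochner_Integration.integrable_diff bias_int s_int m_int)
  qed
  also have "(LINT x|lborel. (?m x - f x)\<^sup>2 + (?s x - (?m x)\<^sup>2) / n)
     = (LINT x|lborel. (?m x - f x)\<^sup>2) + ((LINT x|lborel. (q x)\<^sup>2) - (LINT x|lborel. (?m x)\<^sup>2)) / n"
    using bias_int s_int m_int by (simp add: \<mu>.integral_second_moment[OF q])
  finally show ?thesis .
qed


definition rescale :: "real \<Rightarrow> (real \<Rightarrow> real) \<Rightarrow> real \<Rightarrow> real" where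
  "rescale h L x = L (x / h) / h"

lemma rescale_measurable [measurable]:
  assumes [measurable]: "L \<in> borel_measurable borel"
  shows "rescale h L \<in> borel_measurable borel"
  unfolding rescale_def by measurable

text \<open>Absorbing the bandwidth into the kernel makes every estimator a plain sample average.\<close>

lemma kernel_estimator_rescale:
  "kernel_estimator L xs n h x = 1 / n * (\<Sum>j=1..n. rescale h L (x - xs j))"
  by (simp add: kernel_estimator_def rescale_def sum_divide_distrib[symmetric])

lemma
  assumes L: "square_integrable L" and "h > 0"
  shows square_integrable_rescale: "square_integrable (rescale h L)"
    and rescale_L2: "(LINT x|lborel. (rescale h L x)\<^sup>2) = (LINT x|lborel. (L x)\<^sup>2) / h"
proof -
  have [measurable]: "L \<in> borel_measurable borel" and int: "integrable lborel (\<lambda>x. (L x)\<^sup>2)"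
    using L by (auto simp: square_integrable_def)
  have eq: "(\<lambda>x. (rescale h L x)\<^sup>2) = (\<lambda>x. (L (0 + 1 / h * x))\<^sup>2 / h\<^sup>2)"
    by (auto simp: rescale_def power_divide)
  have "integrable lborel (\<lambda>x. (L (0 + 1 / h * x))\<^sup>2)"
    using lborel_integrable_real_affine[OF int, of "1 / h" 0] \<open>h > 0\<close> by simp
  then show "square_integrable (rescale h L)"
    unfolding square_integrable_def eq by simp
  have "(LINT x|lborel. (L x)\<^sup>2) = \<bar>1 / h\<bar> *\<^sub>R (LINT x|lborel. (L (0 + 1 / h * x))\<^sup>2)"
    using \<open>h > 0\<close> by (intro lborel_integral_real_affine) simp
  then show "(LINT x|lborel. (rescale h L x)\<^sup>2) = (LINT x|lborel. (L x)\<^sup>2) / h"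
    unfolding eq using \<open>h > 0\<close> by (simp add: power2_eq_square)
qed

lemma prob_density_integrable:
  assumes "prob_density f"
  shows "integrable lborel f"
  using assms by (intro integrableI_nonneg) (auto simp: prob_density_def)

lemma real_distribution_density:
  assumes "prob_density f"
  shows "real_distribution (density lborel (\<lambda>x. ennreal (f x)))"
proof -
  have "prob_space (density lborel (\<lambda>x. ennreal (f x)))"
    using assms by (intro prob_spaceI) (simp add: emeasure_density prob_density_def)
  then show ?thesis by (simp add: real_distribution_def real_distribution_axioms_def)
qed

lemma prob_density_rescale:
  assumes K: "prob_density K" and "h > 0"
  shows "prob_density (rescale h K)"
proof -
  have [measurable]: "K \<in> borel_measurable borel" and K0: "\<And>x. 0 \<le> K x" and K1: "(\<integral>\<^sup>+x. ennreal (K x) \<partial>lborel) = 1"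
    using K by (auto simp: prob_density_def)
  have "(\<integral>\<^sup>+x. ennreal (rescale h K x) \<partial>lborel) = ennreal h * (\<integral>\<^sup>+x. ennreal (rescale h K (0 + h * x)) \<partial>lborel)"
    using \<open>h > 0\<close> by (subst nn_integral_real_affine[of _ h 0]) (auto simp: rescale_def)
  also have "\<dots> = (\<integral>\<^sup>+x. ennreal (K x) \<partial>lborel)"
    using \<open>h > 0\<close> K0 by (subst nn_integral_cmult[symmetric]) (auto simp: rescale_def ennreal_mult'[symmetric])
  finally show ?thesis
    using K0 K1 \<open>h > 0\<close> unfolding prob_density_def by (intro conjI allI rescale_measurable) (simp_all add: rescale_def[of h K])
qed

lemma fourier_density:
  assumes "prob_density f"
  shows "fourier (\<lambda>x. complex_of_real (f x)) t = char (density lborel (\<lambda>x. ennreal (f x))) t"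
  using assms unfolding fourier_def char_def prob_density_def
  by (subst integral_density) (auto simp: scaleR_conv_of_real)

lemma fourier_rescale:
  assumes "h > 0"
  shows "fourier (\<lambda>x. complex_of_real (rescale h K x)) t = fourier (\<lambda>x. complex_of_real (K x)) (h * t)"
proof -
  have "fourier (\<lambda>x. complex_of_real (rescale h K x)) t
      = \<bar>h\<bar> *\<^sub>R (CLINT x|lborel. complex_of_real (rescale h K (0 + h * x)) * iexp (t * (0 + h * x)))"
    unfolding fourier_def using assms by (intro lborel_integral_real_affine) simp
  also have "\<dots> = (CLINT x|lborel. \<bar>h\<bar> *\<^sub>R (complex_of_real (rescale h K (0 + h * x)) * iexp (t * (0 + h * x))))"
    by (rule integral_scaleR_right[symmetric])
  also have "\<dots> = fourier (\<lambda>x. complex_of_real (K x)) (h * t)"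
    unfolding fourier_def using assms
    by (intro Bochner_Integration.integral_cong) (auto simp: rescale_def scaleR_conv_of_real field_simps)
  finally show ?thesis .
qed

text \<open>The convolution theorem: the substitution \<open>x = y + z\<close> splits the exponential into a factor
  in \<open>y\<close> and a factor in \<open>z\<close>.\<close>

lemma
  assumes \<mu>: "real_distribution \<mu>" and k: "integrable lborel k"
  shows integrable_smoothing: "integrable lborel (smoothing \<mu> k)"
    and fourier_smoothing: "fourier (\<lambda>x. complex_of_real (smoothing \<mu> k x)) t
      = char \<mu> t * fourier (\<lambda>x. complex_of_real (k x)) t"
proof -
  interpret real_distribution \<mu> by fact
  interpret P: pair_sigma_finite \<mu> lborel ..
  have [measurable]: "k \<in> borel_measurable borel" using k by (simp add: integrable_iff_bounded)
  have shift: "integrable lborel (\<lambda>x. k (x - y))" for y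
    using lborel_integrable_real_affine[OF k, of 1 "- y"] by simp
  have shift_abs: "(LINT x|lborel. \<bar>k (x - y)\<bar>) = (LINT x|lborel. \<bar>k x\<bar>)" for y
    using lborel_integral_real_affine[of 1 "\<lambda>x. \<bar>k x\<bar>" "- y"] by simp
  have joint: "integrable (\<mu> \<Otimes>\<^sub>M lborel) (\<lambda>(y, x). complex_of_real (k (x - y)) * iexp (t * x))" for t
  proof (rule P.Fubini_integrable)
    show "integrable \<mu> (\<lambda>y. LINT x|lborel. norm (case (y, x) of (y, x) \<Rightarrow> complex_of_real (k (x - y)) * iexp (t * x)))"
      by (simp add: norm_mult shift_abs)
    show "AE y in \<mu>. integrable lborel (\<lambda>x. case (y, x) of (y, x) \<Rightarrow> complex_of_real (k (x - y)) * iexp (t * x))"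
      using fourier_integrable[OF integrable_of_real[OF shift]] by simp
  qed measurable
  have m: "complex_of_real (smoothing \<mu> k x) * iexp (t * x) = (CLINT y|\<mu>. complex_of_real (k (x - y)) * iexp (t * x))" for x t
    unfolding smoothing_def by simp
  have "integrable lborel (\<lambda>x. complex_of_real (smoothing \<mu> k x) * iexp (0 * x))"
    unfolding m by (rule P.integrable_snd[OF joint])
  then show "integrable lborel (smoothing \<mu> k)"
    by (simp add: complex_of_real_integrable_eq)
  have "fourier (\<lambda>x. complex_of_real (smoothing \<mu> k x)) t
     = (CLINT y|\<mu>. CLINT x|lborel. complex_of_real (k (x - y)) * iexp (t * x))"
    unfolding fourier_def m by (rule P.Fubini_integral[OF joint])
  also have "\<dots> = (CLINT y|\<mu>. iexp (t * y) * fourier (\<lambda>x. complex_of_real (k x)) t)"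
  proof (rule Bochner_Integration.integral_cong[OF refl])
    fix y
    have "(CLINT x|lborel. complex_of_real (k (x - y)) * iexp (t * x))
       = (CLINT x|lborel. complex_of_real (k x) * iexp (t * (y + x)))"
      using lborel_integral_real_affine[of 1 "\<lambda>x. complex_of_real (k (x - y)) * iexp (t * x)" y] by simp
    also have "\<dots> = (CLINT x|lborel. iexp (t * y) * (complex_of_real (k x) * iexp (t * x)))"
      by (intro Bochner_Integration.integral_cong) (auto simp: exp_add ring_distribs)
    also have "\<dots> = iexp (t * y) * fourier (\<lambda>x. complex_of_real (k x)) t"
      by (simp only: integral_mult_right_zero fourier_def)
    finally show "(CLINT x|lborel. complex_of_real (k (x - y)) * iexp (t * x)) = \<dots>" .
  qed
  also have "\<dots> = char \<mu> t * fourier (\<lambda>x. complex_of_real (k x)) t"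
    by (simp only: integral_mult_left_zero char_def)
  finally show "fourier (\<lambda>x. complex_of_real (smoothing \<mu> k x)) t = \<dots>" .
qed

text \<open>Convolution of two densities is symmetric. This allows the mean of the estimator to be bounded by
  the norm of the kernel as well as by the norm of the sampled density.\<close>

lemma smoothing_commute:
  assumes "prob_density f" "prob_density k"
  shows "smoothing (density lborel (\<lambda>x. ennreal (f x))) k = smoothing (density lborel (\<lambda>x. ennreal (k x))) f"
proof
  fix x
  have [measurable]: "f \<in> borel_measurable borel" "k \<in> borel_measurable borel"
    and "\<And>x. 0 \<le> f x" "\<And>x. 0 \<le> k x" using assms by (auto simp: prob_density_def)
  then show "smoothing (density lborel (\<lambda>x. ennreal (f x))) k x = smoothing (density lborel (\<lambda>x. ennreal (k x))) f x"
    unfolding smoothing_def using lborel_integral_real_affine[of "-1" "\<lambda>y. f y * k (x - y)" x]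
    by (simp add: integral_real_density mult.commute)
qed

section \<open>A lower risk bound for kernels that are densities\<close>

text \<open>The bias is an integrable function with transform \<open>char \<mu> t * (char \<kappa> t - 1)\<close>, so the
  Bessel inequality bounds its norm from below by the norm of that transform.\<close>

lemma bias_fourier_bound:
  assumes f: "prob_density f" "square_integrable f" and k: "prob_density k" "square_integrable k"
  defines "\<mu> \<equiv> density lborel (\<lambda>x. ennreal (f x))" and "\<kappa> \<equiv> density lborel (\<lambda>x. ennreal (k x))"
  shows "(\<integral>\<^sup>+t. ennreal ((cmod (char \<mu> t * (1 - char \<kappa> t)))\<^sup>2) \<partial>lborel)
    \<le> ennreal (2 * pi * (LINT x|lborel. (smoothing \<mu> k x - f x)\<^sup>2))"
proof -
  have \<mu>: "real_distribution \<mu>" unfolding \<mu>_def by (rule real_distribution_density[OF f(1)])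
  let ?F = "\<lambda>x. complex_of_real (smoothing \<mu> k x - f x)"
  have sm: "integrable lborel (\<lambda>x. complex_of_real (smoothing \<mu> k x))"
    using integrable_smoothing[OF \<mu> prob_density_integrable[OF k(1)]] by simp
  have fi: "integrable lborel (\<lambda>x. complex_of_real (f x))"
    using prob_density_integrable[OF f(1)] by simp
  have F: "integrable lborel ?F"
    using Bochner_Integration.integrable_diff[OF sm fi] by simp
  have "fourier ?F t = fourier (\<lambda>x. complex_of_real (smoothing \<mu> k x)) t - fourier (\<lambda>x. complex_of_real (f x)) t" for t
    unfolding fourier_def
    by (subst Bochner_Integration.integral_diff[OF fourier_integrable[OF sm] fourier_integrable[OF fi], symmetric])
       (simp add: left_diff_distrib)
  then have "fourier ?F t = - (char \<mu> t * (1 - char \<kappa> t))" for t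
    by (simp add: fourier_smoothing[OF \<mu> prob_density_integrable[OF k(1)]] fourier_density[OF f(1)]
        fourier_density[OF k(1)] \<mu>_def[symmetric] \<kappa>_def[symmetric] algebra_simps)
  then have "(\<integral>\<^sup>+t. ennreal ((cmod (char \<mu> t * (1 - char \<kappa> t)))\<^sup>2) \<partial>lborel)
     = (\<integral>\<^sup>+t. ennreal ((cmod (fourier ?F t))\<^sup>2) \<partial>lborel)" by simp
  also have "\<dots> \<le> ennreal (2 * pi) * (\<integral>\<^sup>+x. ennreal ((cmod (?F x))\<^sup>2) \<partial>lborel)"
    by (rule bessel_fourier[OF F])
  also have "(\<integral>\<^sup>+x. ennreal ((cmod (?F x))\<^sup>2) \<partial>lborel) = ennreal (LINT x|lborel. (smoothing \<mu> k x - f x)\<^sup>2)"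
    using integrable_square_diff[OF real_distribution.square_integrable_smoothing[OF \<mu> k(2)] f(2)]
    by (subst nn_integral_eq_integral[symmetric]) (auto simp del: of_real_diff)
  finally show ?thesis by (simp add: ennreal_mult')
qed

text \<open>The Fourier lower bound is restricted to a fixed interval \<open>[\<tau> / 2, \<tau>]\<close> of small positive
  frequencies. There \<open>char \<mu>\<close> is at least 1/2 by continuity, and \<open>1 - char \<kappa> (h * t)\<close> is at
  least of order \<open>h\<^sup>2\<close>. The interval can be chosen independent of \<open>h\<close> because \<open>h\<close> is bounded,
  which keeps \<open>h * t\<close> in the range where the quadratic bound is valid.\<close>

lemma kernel_bias_ge_h4:
  assumes f: "prob_density f" "square_integrable f" and K: "prob_density K" "square_integrable K" and "H > 0"
  obtains c where "c > 0"
    "\<And>h. 0 < h \<Longrightarrow> h \<le> H \<Longrightarrow>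
      c * h ^ 4 \<le> (LINT x|lborel. (smoothing (density lborel (\<lambda>x. ennreal (f x))) (rescale h K) x - f x)\<^sup>2)"
proof -
  define \<mu> where "\<mu> = density lborel (\<lambda>x. ennreal (f x))"
  interpret real_distribution \<mu> unfolding \<mu>_def by (rule real_distribution_density[OF f(1)])
  obtain c \<delta> where c: "c > 0" and "\<delta> > 0"
    and charK: "\<And>u. \<bar>u\<bar> \<le> \<delta> \<Longrightarrow> c * u\<^sup>2 \<le> cmod (1 - char (density lborel (\<lambda>x. ennreal (K x))) u)"
    using one_minus_char_ge_square[OF K(1)] by blast
  have "(\<lambda>t. cmod (char \<mu> t)) \<midarrow>0\<rightarrow> cmod (char \<mu> 0)"
    using isCont_char[of 0] unfolding isCont_def by (rule tendsto_norm)
  then have "\<forall>\<^sub>F t in at 0. 1 / 2 < cmod (char \<mu> t)"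
    by (rule order_tendstoD) (simp add: char_zero)
  then obtain t1 where "t1 > 0" and t1: "\<And>t. t \<noteq> 0 \<Longrightarrow> \<bar>t\<bar> < t1 \<Longrightarrow> 1 / 2 < cmod (char \<mu> t)"
    by (auto simp: eventually_at dist_real_def)
  define \<tau> where "\<tau> = min (t1 / 2) (\<delta> / H)"
  have \<tau>: "\<tau> > 0" "\<tau> < t1" "\<tau> * H \<le> \<delta>"
    using \<open>t1 > 0\<close> \<open>\<delta> > 0\<close> \<open>H > 0\<close> by (auto simp: \<tau>_def min_def field_simps)
  define d where "d = (1 / 2 * (c * (\<tau> / 2)\<^sup>2))\<^sup>2"
  have "d > 0" using c \<tau> by (auto simp: d_def)
  show thesis
  proof (rule that)
    show "d * (\<tau> / 2) / (2 * pi) > 0" using \<open>d > 0\<close> \<tau>(1) by simp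
    fix h :: real assume h: "0 < h" "h \<le> H"
    let ?k = "rescale h K" and ?B = "LINT x|lborel. (smoothing \<mu> (rescale h K) x - f x)\<^sup>2"
    let ?\<kappa> = "density lborel (\<lambda>x. ennreal (?k x))"
    have k: "prob_density ?k" "square_integrable ?k"
      by (rule prob_density_rescale[OF K(1) h(1)], rule square_integrable_rescale[OF K(2) h(1)])
    have char_k: "char ?\<kappa> t = char (density lborel (\<lambda>x. ennreal (K x))) (h * t)" for t
      unfolding fourier_density[OF k(1), symmetric] fourier_density[OF K(1), symmetric]
      by (rule fourier_rescale[OF h(1)])
    have "ennreal (d * h ^ 4 * (\<tau> / 2)) = (\<integral>\<^sup>+t. ennreal (d * h ^ 4) * indicator {\<tau> / 2..\<tau>} t \<partial>lborel)"
      using \<tau>(1) by (subst nn_integral_cmult_indicator) (auto simp: ennreal_mult''[symmetric])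
    also have "\<dots> \<le> (\<integral>\<^sup>+t. ennreal ((cmod (char \<mu> t * (1 - char ?\<kappa> t)))\<^sup>2) \<partial>lborel)"
    proof (rule nn_integral_mono)
      fix t
      show "ennreal (d * h ^ 4) * indicator {\<tau> / 2..\<tau>} t \<le> ennreal ((cmod (char \<mu> t * (1 - char ?\<kappa> t)))\<^sup>2)"
      proof (cases "t \<in> {\<tau> / 2..\<tau>}")
        case True
        have "t > 0" "\<bar>t\<bar> < t1" using True \<tau> by auto
        then have "1 / 2 \<le> cmod (char \<mu> t)" using t1[of t] by simp
        moreover have "c * (h * (\<tau> / 2))\<^sup>2 \<le> cmod (1 - char ?\<kappa> t)"
        proof -
          have "h * t \<le> H * \<tau>" using True h \<tau>(1) by (intro mult_mono) auto
          then have "\<bar>h * t\<bar> \<le> \<delta>" using \<tau>(3) h(1) \<open>t > 0\<close> by (simp add: mult.commute)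
          moreover have "c * (h * (\<tau> / 2))\<^sup>2 \<le> c * (h * t)\<^sup>2"
            using True h \<tau>(1) c by (intro mult_left_mono power_mono) auto
          ultimately show ?thesis using charK[of "h * t"] by (simp add: char_k)
        qed
        ultimately have "1 / 2 * (c * (h * (\<tau> / 2))\<^sup>2) \<le> cmod (char \<mu> t * (1 - char ?\<kappa> t))"
          unfolding norm_mult using c by (intro mult_mono) auto
        then have "(1 / 2 * (c * (h * (\<tau> / 2))\<^sup>2))\<^sup>2 \<le> (cmod (char \<mu> t * (1 - char ?\<kappa> t)))\<^sup>2"
          using c by (intro power_mono) auto
        moreover have "d * h ^ 4 = (1 / 2 * (c * (h * (\<tau> / 2))\<^sup>2))\<^sup>2"
          by (simp add: d_def power2_eq_square power4_eq_xxxx)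
        ultimately show ?thesis using True by (simp add: ennreal_leI)
      qed simp
    qed
    also have "\<dots> \<le> ennreal (2 * pi * ?B)"
      using bias_fourier_bound[OF f k] by (simp only: \<mu>_def)
    finally have "d * h ^ 4 * (\<tau> / 2) \<le> 2 * pi * ?B"
      by (subst (asm) ennreal_le_iff) (auto intro!: Bochner_Integration.integral_nonneg)
    then show "d * (\<tau> / 2) / (2 * pi) * h ^ 4
      \<le> (LINT x|lborel. (smoothing (density lborel (\<lambda>x. ennreal (f x))) ?k x - f x)\<^sup>2)"
      unfolding \<mu>_def by (simp add: field_simps)
  qed
qed

lemma integral_square_pos:
  assumes "prob_density f" "square_integrable f"
  shows "0 < (LINT x|lborel. (f x)\<^sup>2)"
proof (rule ccontr)
  assume "\<not> 0 < (LINT x|lborel. (f x)\<^sup>2)"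
  then have "(LINT x|lborel. (f x)\<^sup>2) = 0"
    by (metis Bochner_Integration.integral_nonneg less_eq_real_def zero_le_power2)
  then have "AE x in lborel. (f x)\<^sup>2 = 0"
    using assms(2) by (subst (asm) integral_nonneg_eq_0_iff_AE) (auto simp: square_integrable_def)
  then have "(\<integral>\<^sup>+x. ennreal (f x) \<partial>lborel) = 0"
    using assms(1) by (subst nn_integral_0_iff_AE) (auto simp: prob_density_def elim!: eventually_mono)
  then show False using assms(1) by (simp add: prob_density_def)
qed

text \<open>Let \<open>A\<close> and \<open>B\<close> be the square integrals of \<open>K\<close> and \<open>f\<close>. Three regimes are distinguished.
  If \<open>h > 4 * A / B\<close>, the mean of the estimator is too small in norm to approximate \<open>f\<close>, and the squared
  bias alone exceeds a constant. If \<open>h\<close> is at most \<open>4 * A / B\<close>, the squared bias is at least of order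
  \<open>h ^ 4\<close>, which is enough when \<open>h\<close> exceeds \<open>n powr (- 1 / 5)\<close> or a constant. Below both
  thresholds, the variance is at least \<open>A / (2 * n * h)\<close>, and \<open>1 / h\<close> exceeds
  \<open>n powr (1 / 5)\<close>.\<close>

lemma kernel_risk_lower_bound:
  assumes f: "prob_density f" "square_integrable f" and K: "prob_density K" "square_integrable K"
  defines "\<mu> \<equiv> density lborel (\<lambda>x. ennreal (f x))"
  obtains C where "C > 0"
    "\<And>n h. n > 0 \<Longrightarrow> h > 0 \<Longrightarrow> C * real n powr (- (4 / 5)) \<le>
      (LINT x|lborel. (smoothing \<mu> (rescale h K) x - f x)\<^sup>2)
        + ((LINT x|lborel. (rescale h K x)\<^sup>2) - (LINT x|lborel. (smoothing \<mu> (rescale h K) x)\<^sup>2)) / real n"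
proof -
  interpret real_distribution \<mu> unfolding \<mu>_def by (rule real_distribution_density[OF f(1)])
  define A B where "A = (LINT x|lborel. (K x)\<^sup>2)" and "B = (LINT x|lborel. (f x)\<^sup>2)"
  have AB: "A > 0" "B > 0" unfolding A_def B_def by (rule integral_square_pos[OF K], rule integral_square_pos[OF f])
  obtain c where c: "c > 0" and bias4: "\<And>h. 0 < h \<Longrightarrow> h \<le> 4 * A / B \<Longrightarrow>
      c * h ^ 4 \<le> (LINT x|lborel. (smoothing \<mu> (rescale h K) x - f x)\<^sup>2)"
    using kernel_bias_ge_h4[OF f K, of "4 * A / B"] AB unfolding \<mu>_def by auto
  \<comment> \<open>Below this bandwidth the square integral of the smoothed density, which is at most
    \<open>B\<close>, takes away at most half of the term \<open>A / h\<close> in the variance.\<close>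
  define h1 where "h1 = A / (2 * B)"
  have "h1 > 0" using AB by (simp add: h1_def)
  define C where "C = Min {B / 4, c, c * h1 ^ 4, A / 2}"
  have C: "C > 0" "C \<le> B / 4" "C \<le> c" "C \<le> c * h1 ^ 4" "C \<le> A / 2"
    using AB c \<open>h1 > 0\<close> by (auto simp: C_def)
  show thesis
  proof (rule that[OF C(1)])
    fix n :: nat and h :: real assume "n > 0" and h: "h > 0"
    let ?m = "smoothing \<mu> (rescale h K)"
    let ?bias = "LINT x|lborel. (?m x - f x)\<^sup>2" and ?V = "(LINT x|lborel. (rescale h K x)\<^sup>2) - (LINT x|lborel. (?m x)\<^sup>2)"
    let ?r = "real n powr (- (4 / 5))"
    have k: "prob_density (rescale h K)" "square_integrable (rescale h K)"
      by (rule prob_density_rescale[OF K(1) h], rule square_integrable_rescale[OF K(2) h])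
    have kA: "(LINT x|lborel. (rescale h K x)\<^sup>2) = A / h" unfolding A_def by (rule rescale_L2[OF K(2) h])
    have mL2: "square_integrable ?m" by (rule square_integrable_smoothing[OF k(2)])
    have mA: "(LINT x|lborel. (?m x)\<^sup>2) \<le> A / h" unfolding kA[symmetric] by (rule smoothing_L2_le[OF k(2)])
    have mB: "(LINT x|lborel. (?m x)\<^sup>2) \<le> B"
      unfolding \<mu>_def smoothing_commute[OF f(1) k(1)] B_def
      by (rule real_distribution.smoothing_L2_le[OF real_distribution_density[OF k(1)] f(2)])
    have r: "0 < ?r" "?r \<le> 1" using \<open>n > 0\<close> by (auto intro!: powr_le1 simp: powr_minus_divide ge_one_powr_ge_zero)
    have bias0: "0 \<le> ?bias" by (intro Bochner_Integration.integral_nonneg) simp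
    have V0: "0 \<le> ?V / n" using mA kA by simp
    show "C * ?r \<le> ?bias + ?V / n"
    proof (cases "h \<le> 4 * A / B")
      case False
      have int: "integrable lborel (\<lambda>x. (f x)\<^sup>2)" "integrable lborel (\<lambda>x. (?m x)\<^sup>2)"
        using f(2) mL2 by (auto simp: square_integrable_def)
      have "B / 2 - (LINT x|lborel. (?m x)\<^sup>2) = (LINT x|lborel. (f x)\<^sup>2 / 2 - (?m x)\<^sup>2)"
        using int by (simp add: B_def)
      also have "\<dots> \<le> ?bias"
      proof (rule integral_mono)
        fix x
        \<comment> \<open>The difference of the two sides of the claim is this square.\<close>
        have "0 \<le> 2 * (?m x - f x / 2)\<^sup>2" by simp
        then show "(f x)\<^sup>2 / 2 - (?m x)\<^sup>2 \<le> (?m x - f x)\<^sup>2"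
          by (simp add: power2_eq_square algebra_simps)
      qed (use int integrable_square_diff[OF mL2 f(2)] in auto)
      finally have "B / 2 - A / h \<le> ?bias" using mA by simp
      moreover have "A / h \<le> B / 4" using False AB h by (simp add: field_simps)
      ultimately have "B / 4 \<le> ?bias" by simp
      moreover have "C * ?r \<le> B / 4 * 1" using C r AB by (intro mult_mono) auto
      ultimately show ?thesis using V0 by simp
    next
      case True
      note bias = bias4[OF h True]
      show ?thesis
      proof (cases "h \<ge> real n powr (- (1 / 5)) \<or> h \<ge> h1")
        case True
        have "C * ?r \<le> c * h ^ 4"
        proof (cases "h \<ge> h1")
          case True
          have "C * ?r \<le> c * h1 ^ 4 * 1" using C r c by (intro mult_mono) auto
          also have "\<dots> \<le> c * h ^ 4" using True \<open>h1 > 0\<close> c by (simp add: power_mono)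
          finally show ?thesis .
        next
          case False
          then have "(real n powr (- (1 / 5))) ^ 4 \<le> h ^ 4" using True by (intro power_mono) auto
          moreover have "(real n powr (- (1 / 5))) ^ 4 = ?r" using \<open>n > 0\<close> by (simp add: powr_power)
          ultimately show ?thesis using C c r by (intro mult_mono) auto
        qed
        then show ?thesis using bias V0 by simp
      next
        case False
        have "B \<le> A / (2 * h)" using False AB h by (simp add: h1_def field_simps)
        then have "A / (2 * h) \<le> ?V" using mB kA by (simp add: field_simps)
        moreover have "A / 2 * real n powr (1 / 5) \<le> A / (2 * h)"
          using False AB h \<open>n > 0\<close> by (simp add: powr_minus_divide field_simps)
        ultimately have "A / 2 * real n powr (1 / 5) / n \<le> ?V / n"
          by (intro divide_right_mono) auto
        moreover have "A / 2 * real n powr (1 / 5) / n = A / 2 * ?r"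
          using \<open>n > 0\<close> powr_diff[of "real n" "1 / 5" 1] by simp
        moreover have "C * ?r \<le> A / 2 * ?r" using C r by (intro mult_right_mono) auto
        ultimately show ?thesis using bias0 by linarith
      qed
    qed
  qed
qed

section \<open>The sinc kernel\<close>

text \<open>The defining feature of the sinc kernel: its transform is exactly 1 on \<open>[-1 / h, 1 / h]\<close> and 0
  outside, so that low frequencies are reproduced without bias. The half-open interval is the one
  that occurs in inversion formulas.\<close>

lemma sinc_eq_inverse_fourier:
  assumes "h > 0"
  shows "complex_of_real (rescale h sinc_kernel x)
     = inverse_fourier (\<lambda>t. complex_of_real (indicator {- (1 / h)<..1 / h} t)) x"
proof (cases "x = 0")
  case True
  then show ?thesis using assms by (simp add: rescale_def sinc_kernel_def inverse_fourier_def)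
next
  case False
  let ?T = "1 / h"
  have "(CLINT t|lborel. complex_of_real (indicator {- ?T<..?T} t) * iexp (- (t * x)))
     = (CLINT t|lborel. indicator {- ?T<..?T} t *\<^sub>R iexp (- (x * t)))"
    by (simp add: scaleR_conv_of_real mult.commute)
  also have "\<dots> = (iexp (- (x * - ?T)) - iexp (- (x * ?T))) / (\<i> * x)"
    using assms False by (intro iexp_integral_interval) auto
  also have "\<dots> = complex_of_real (2 * sin (x / h) / x)"
    using False by (simp add: complex_eq_iff Re_divide Im_divide Re_exp Im_exp power2_eq_square)
  finally show ?thesis
    using False assms by (simp add: rescale_def sinc_kernel_def inverse_fourier_def)
qed

lemma integrable_indicator_Ioc: "integrable lborel (\<lambda>t. complex_of_real (indicator {a<..b::real} t))"
proof -
  have "emeasure lborel {a<..b} < \<infinity>" by (cases "a \<le> b") auto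
  then show ?thesis by (simp add: complex_of_real_integrable_eq)
qed

text \<open>The Bessel inequality for the inverse transform of an indicator bounds the norm.\<close>

lemma square_integrable_sinc: "square_integrable sinc_kernel"
proof -
  have [measurable]: "sinc_kernel \<in> borel_measurable borel"
    unfolding sinc_kernel_def[abs_def] by measurable
  have "(cmod (inverse_fourier (\<lambda>t. complex_of_real (indicator {-1<..1} t)) x))\<^sup>2 = (sinc_kernel x)\<^sup>2" for x
  proof -
    have "inverse_fourier (\<lambda>t. complex_of_real (indicator {-1<..1} t)) x = complex_of_real (sinc_kernel x)"
      using sinc_eq_inverse_fourier[of 1 x] by (simp add: rescale_def)
    then show ?thesis by (simp only: norm_of_real power2_abs)
  qed
  then have "(\<integral>\<^sup>+x. ennreal ((sinc_kernel x)\<^sup>2) \<partial>lborel)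
     = (\<integral>\<^sup>+x. ennreal ((cmod (inverse_fourier (\<lambda>t. complex_of_real (indicator {-1<..1} t)) x))\<^sup>2) \<partial>lborel)"
    by simp
  also have "\<dots> \<le> ennreal (1 / (2 * pi)) * (\<integral>\<^sup>+t. ennreal ((cmod (complex_of_real (indicator {-1<..1::real} t)))\<^sup>2) \<partial>lborel)"
    by (rule bessel_inverse_fourier[OF integrable_indicator_Ioc])
  also have "(\<integral>\<^sup>+t. ennreal ((cmod (complex_of_real (indicator {-1<..1::real} t)))\<^sup>2) \<partial>lborel)
     = (\<integral>\<^sup>+t. indicator {-1<..1::real} t \<partial>lborel)"
    by (intro nn_integral_cong) (simp add: indicator_def)
  also have "ennreal (1 / (2 * pi)) * \<dots> < \<infinity>" by (simp add: ennreal_mult_less_top)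
  finally show ?thesis
    by (simp add: square_integrable_def integrable_iff_bounded)
qed

text \<open>Smoothing with the sinc kernel truncates the characteristic function at frequency \<open>1 / h\<close>.\<close>

lemma smoothing_sinc:
  assumes \<mu>: "real_distribution \<mu>" and "h > 0"
  shows "complex_of_real (smoothing \<mu> (rescale h sinc_kernel) x)
    = inverse_fourier (\<lambda>t. complex_of_real (indicator {- (1 / h)<..1 / h} t) * char \<mu> t) x"
proof -
  interpret real_distribution \<mu> by fact
  interpret P: pair_sigma_finite \<mu> lborel ..
  let ?i = "\<lambda>t. complex_of_real (indicator {- (1 / h)<..1 / h} t)"
  have joint: "integrable (\<mu> \<Otimes>\<^sub>M lborel) (\<lambda>(y, t). ?i t * iexp (- (t * (x - y))))"
  proof (rule P.Fubini_integrable)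
    show "integrable \<mu> (\<lambda>y. LINT t|lborel. norm (case (y, t) of (y, t) \<Rightarrow> ?i t * iexp (- (t * (x - y)))))"
      by (simp add: norm_mult del: of_real_minus of_real_mult of_real_diff)
    show "AE y in \<mu>. integrable lborel (\<lambda>t. case (y, t) of (y, t) \<Rightarrow> ?i t * iexp (- (t * (x - y))))"
    proof (intro AE_I2)
      fix y
      have "integrable lborel (\<lambda>t. ?i t * iexp (- (t * (x - y))))"
        by (rule Bochner_Integration.integrable_bound[OF integrable_indicator_Ioc[of "- (1 / h)" "1 / h"]])
           (measurable, auto simp: norm_mult)
      then show "integrable lborel (\<lambda>t. case (y, t) of (y, t) \<Rightarrow> ?i t * iexp (- (t * (x - y))))" by simp
    qed
  qed measurable
  have "complex_of_real (smoothing \<mu> (rescale h sinc_kernel) x)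
     = (CLINT y|\<mu>. complex_of_real (rescale h sinc_kernel (x - y)))"
    by (simp add: smoothing_def)
  also have "\<dots> = (CLINT y|\<mu>. 1 / (2 * pi) * (CLINT t|lborel. ?i t * iexp (- (t * (x - y)))))"
    unfolding sinc_eq_inverse_fourier[OF \<open>h > 0\<close>] inverse_fourier_def ..
  also have "\<dots> = 1 / (2 * pi) * (CLINT y|\<mu>. CLINT t|lborel. ?i t * iexp (- (t * (x - y))))"
    by (simp only: integral_mult_right_zero)
  also have "(CLINT y|\<mu>. CLINT t|lborel. ?i t * iexp (- (t * (x - y))))
     = (CLINT t|lborel. CLINT y|\<mu>. ?i t * iexp (- (t * (x - y))))"
    by (rule P.Fubini_integral[OF joint, symmetric])
  also have "\<dots> = (CLINT t|lborel. ?i t * char \<mu> t * iexp (- (t * x)))"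
  proof (rule Bochner_Integration.integral_cong[OF refl])
    fix t
    have "(CLINT y|\<mu>. ?i t * iexp (- (t * (x - y)))) = (CLINT y|\<mu>. (?i t * iexp (- (t * x))) * iexp (t * y))"
      by (intro Bochner_Integration.integral_cong) (auto simp: exp_diff exp_minus ring_distribs divide_inverse mult.commute)
    also have "\<dots> = ?i t * char \<mu> t * iexp (- (t * x))"
      unfolding char_def by (simp only: integral_mult_right_zero) (simp only: mult_ac)
    finally show "(CLINT y|\<mu>. ?i t * iexp (- (t * (x - y)))) = \<dots>" .
  qed
  finally show ?thesis by (simp only: inverse_fourier_def)
qed

text \<open>By Fourier inversion the bias is the inverse transform of the part of \<open>char \<mu>\<close> that the sinc
  kernel cuts off. The factor \<open>1 / (2 * pi)\<close> of the Bessel inequality is bounded by 1.\<close>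

lemma sinc_bias_le_tail:
  assumes f: "prob_density f" "square_integrable f" and "h > 0"
  defines "\<mu> \<equiv> density lborel (\<lambda>x. ennreal (f x))"
  assumes char_int: "integrable lborel (char \<mu>)"
  shows "ennreal (LINT x|lborel. (smoothing \<mu> (rescale h sinc_kernel) x - f x)\<^sup>2)
    \<le> (\<integral>\<^sup>+t. ennreal ((cmod (char \<mu> t))\<^sup>2) * indicator (- {- (1 / h)<..1 / h}) t \<partial>lborel)"
proof -
  have \<mu>: "real_distribution \<mu>" unfolding \<mu>_def by (rule real_distribution_density[OF f(1)])
  interpret real_distribution \<mu> by fact
  let ?I = "{- (1 / h)<..1 / h}" and ?m = "smoothing \<mu> (rescale h sinc_kernel)"
  let ?in = "\<lambda>t. complex_of_real (indicator ?I t) * char \<mu> t" and ?out = "\<lambda>t. complex_of_real (indicator (- ?I) t) * char \<mu> t"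
  have int_in: "integrable lborel ?in" and int_out: "integrable lborel ?out"
    by (rule Bochner_Integration.integrable_bound[OF char_int]; auto simp: norm_mult indicator_def)+
  have integrable_iexp: "integrable lborel (\<lambda>t. F t * iexp (- (t * x)))" if "integrable lborel F" for F x
    using fourier_integrable[OF that, of "- x"] by (simp add: mult.commute)
  have split: "inverse_fourier (char \<mu>) x - inverse_fourier ?in x = inverse_fourier ?out x" for x
  proof -
    have "(CLINT t|lborel. char \<mu> t * iexp (- (t * x))) - (CLINT t|lborel. ?in t * iexp (- (t * x)))
       = (CLINT t|lborel. char \<mu> t * iexp (- (t * x)) - ?in t * iexp (- (t * x)))"
      by (rule Bochner_Integration.integral_diff[OF integrable_iexp[OF char_int] integrable_iexp[OF int_in], symmetric])
    also have "\<dots> = (CLINT t|lborel. ?out t * iexp (- (t * x)))"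
      by (intro Bochner_Integration.integral_cong) (auto simp: indicator_def)
    finally show ?thesis by (simp only: inverse_fourier_def right_diff_distrib[symmetric])
  qed
  have "AE x in lborel. complex_of_real (f x) = inverse_fourier (char \<mu>) x"
    by (rule inverse_char_density[OF \<mu> char_int]) (use f(1) in \<open>auto simp: prob_density_def \<mu>_def\<close>)
  then have AE: "AE x in lborel. (?m x - f x)\<^sup>2 = (cmod (inverse_fourier ?out x))\<^sup>2"
  proof eventually_elim
    case (elim x)
    have "complex_of_real (f x - ?m x) = inverse_fourier ?out x"
      using elim smoothing_sinc[OF \<mu> \<open>h > 0\<close>, of x] split[of x] by simp
    then have "(cmod (inverse_fourier ?out x))\<^sup>2 = \<bar>f x - ?m x\<bar>\<^sup>2" by (metis norm_of_real)
    then show ?case by (simp add: power2_commute)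
  qed
  have "ennreal (LINT x|lborel. (?m x - f x)\<^sup>2) = (\<integral>\<^sup>+x. ennreal ((?m x - f x)\<^sup>2) \<partial>lborel)"
    using integrable_square_diff[OF square_integrable_smoothing[OF square_integrable_rescale[OF square_integrable_sinc \<open>h > 0\<close>]] f(2)]
    by (intro nn_integral_eq_integral[symmetric]) auto
  also have "\<dots> = (\<integral>\<^sup>+x. ennreal ((cmod (inverse_fourier ?out x))\<^sup>2) \<partial>lborel)"
    by (rule nn_integral_cong_AE) (use AE in auto)
  also have "\<dots> \<le> ennreal (1 / (2 * pi)) * (\<integral>\<^sup>+t. ennreal ((cmod (?out t))\<^sup>2) \<partial>lborel)"
    by (rule bessel_inverse_fourier[OF int_out])
  also have "\<dots> \<le> 1 * (\<integral>\<^sup>+t. ennreal ((cmod (?out t))\<^sup>2) \<partial>lborel)"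
    using pi_gt3 by (intro mult_right_mono) auto
  also have "\<dots> = (\<integral>\<^sup>+t. ennreal ((cmod (char \<mu> t))\<^sup>2) * indicator (- ?I) t \<partial>lborel)"
    by (simp, intro nn_integral_cong) (auto simp: indicator_def)
  finally show ?thesis .
qed

lemma nn_integral_powr_tail:
  fixes p T :: real
  assumes "p > 1" "T > 0"
  shows "(\<integral>\<^sup>+t. ennreal (t powr (- p)) * indicator {T..} t \<partial>lborel) = ennreal (T powr (1 - p) / (p - 1))"
proof -
  have "(\<integral>\<^sup>+t. ennreal (t powr (- p)) * indicator {T..} t \<partial>lborel) = ennreal (0 - T powr (1 - p) / (1 - p))"
  proof (rule nn_integral_FTC_atLeast)
    fix x assume "T \<le> x"
    then show "((\<lambda>x. x powr (1 - p) / (1 - p)) has_real_derivative x powr (- p)) (at x)"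
      using DERIV_cdivide[OF has_real_derivative_powr[of x "1 - p"], of "1 - p"] assms by simp
  next
    have "((\<lambda>x. x powr (1 - p)) \<longlongrightarrow> 0) at_top"
      using assms by (intro tendsto_neg_powr filterlim_ident) auto
    then show "((\<lambda>x. x powr (1 - p) / (1 - p)) \<longlongrightarrow> 0) at_top"
      by (rule tendsto_divide_zero)
  qed auto
  also have "0 - T powr (1 - p) / (1 - p) = T powr (1 - p) / (p - 1)"
    using assms by (simp add: divide_simps) (simp add: algebra_simps)
  finally show ?thesis .
qed

lemma nn_integral_two_sided_tail_le:
  fixes g :: "real \<Rightarrow> real"
  assumes [measurable]: "g \<in> borel_measurable borel" and even: "\<And>t. g (- t) = g t"
    and le: "\<And>t. t \<ge> T \<Longrightarrow> g t \<le> a * t powr (- p)" and "a \<ge> 0" "p > 1" "T > 0"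
  shows "(\<integral>\<^sup>+t. ennreal (g t) * indicator (- {- T<..T}) t \<partial>lborel) \<le> ennreal (2 * a * T powr (1 - p) / (p - 1))"
proof -
  let ?r = "\<integral>\<^sup>+t. ennreal (g t) * indicator {T..} t \<partial>lborel"
  have "(\<integral>\<^sup>+t. ennreal (g t) * indicator (- {- T<..T}) t \<partial>lborel)
     \<le> (\<integral>\<^sup>+t. ennreal (g t) * indicator {T..} t + ennreal (g (- t)) * indicator {T..} (- t) \<partial>lborel)"
    by (intro nn_integral_mono) (auto simp: indicator_def even)
  also have "\<dots> = ?r + (\<integral>\<^sup>+t. ennreal (g (- t)) * indicator {T..} (- t) \<partial>lborel)"
    by (rule nn_integral_add) auto
  also have "(\<integral>\<^sup>+t. ennreal (g (- t)) * indicator {T..} (- t) \<partial>lborel) = ?r"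
    using nn_integral_real_affine[of "\<lambda>t. ennreal (g t) * indicator {T..} t" "-1" 0] by simp
  also have "?r \<le> (\<integral>\<^sup>+t. ennreal a * (ennreal (t powr (- p)) * indicator {T..} t) \<partial>lborel)"
    using le \<open>a \<ge> 0\<close> by (intro nn_integral_mono) (auto simp: indicator_def ennreal_mult'[symmetric] intro!: ennreal_leI)
  also have "\<dots> = ennreal a * ennreal (T powr (1 - p) / (p - 1))"
    by (subst nn_integral_cmult) (simp_all add: nn_integral_powr_tail[OF \<open>p > 1\<close> \<open>T > 0\<close>])
  also have "\<dots> = ennreal (a * T powr (1 - p) / (p - 1))"
    using \<open>a \<ge> 0\<close> by (simp add: ennreal_mult'[symmetric])
  finally have "(\<integral>\<^sup>+t. ennreal (g t) * indicator (- {- T<..T}) t \<partial>lborel)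
    \<le> ennreal (a * T powr (1 - p) / (p - 1)) + ennreal (a * T powr (1 - p) / (p - 1))"
    by (simp add: add_mono)
  also have "\<dots> = ennreal (2 * a * T powr (1 - p) / (p - 1))"
    using assms(4,5) by (subst ennreal_plus[symmetric]) (simp_all flip: add_divide_distrib)
  finally show ?thesis .
qed

section \<open>Comparison of the risks\<close>

lemma (in real_distribution) cmod_char_minus: "cmod (char M (- t)) = cmod (char M t)"
proof -
  have "char M (- t) = (CLINT x|M. cnj (iexp (t * x)))"
    unfolding char_def by (simp add: exp_cnj)
  also have "\<dots> = cnj (char M t)"
    unfolding char_def by (rule Bochner_Integration.integral_cnj)
  finally show ?thesis by simp
qed

text \<open>On a bounded range the characteristic function is at most 1; the decay takes care of the rest.\<close>

lemma (in real_distribution) integrable_char: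
  assumes "p > 1" "T > 0" and le: "\<And>t. t \<ge> T \<Longrightarrow> cmod (char M t) \<le> a * t powr (- p)" and "a \<ge> 0"
  shows "integrable lborel (char M)"
proof (rule integrableI_bounded)
  have "(\<integral>\<^sup>+t. ennreal (cmod (char M t)) \<partial>lborel)
     \<le> (\<integral>\<^sup>+t. indicator {- T<..T} t + ennreal (cmod (char M t)) * indicator (- {- T<..T}) t \<partial>lborel)"
    using cmod_char_le_1 by (intro nn_integral_mono) (auto simp: indicator_def)
  also have "\<dots> = ennreal (2 * T) + (\<integral>\<^sup>+t. ennreal (cmod (char M t)) * indicator (- {- T<..T}) t \<partial>lborel)"
    using \<open>T > 0\<close> by (subst nn_integral_add) auto
  also have "\<dots> \<le> ennreal (2 * T) + ennreal (2 * a * T powr (1 - p) / (p - 1))"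
    by (intro add_left_mono nn_integral_two_sided_tail_le) (use assms cmod_char_minus in auto)
  also have "\<dots> < \<infinity>" by simp
  finally show "(\<integral>\<^sup>+t. ennreal (cmod (char M t)) \<partial>lborel) < \<infinity>" .
qed simp

text \<open>The decay makes the tail integral beyond frequency \<open>1 / h\<close> of order \<open>o(h ^ 4)\<close>, and the
  variance is at most a constant \<open>S\<close> over \<open>n * h\<close>. With \<open>h = D * n powr (- 1 / 5)\<close> both are of
  order \<open>n powr (- 4 / 5)\<close>: a large constant \<open>D\<close> makes the variance small compared with this
  rate, and once \<open>D\<close> is chosen, the \<open>o\<close> in the squared bias outweighs \<open>D ^ 4\<close>.\<close>

lemma sinc_risk_upper_bound:
  assumes f: "prob_density f" "square_integrable f"
  defines "\<mu> \<equiv> density lborel (\<lambda>x. ennreal (f x))"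
  assumes decay: "(\<lambda>t. cmod (char \<mu> t)) \<in> o[at_top](\<lambda>t. 1 / t powr (5 / 2))" and "\<epsilon> > 0"
  shows "\<forall>\<^sub>F n in sequentially. \<exists>h>0.
      (LINT x|lborel. (smoothing \<mu> (rescale h sinc_kernel) x - f x)\<^sup>2)
        + ((LINT x|lborel. (rescale h sinc_kernel x)\<^sup>2)
            - (LINT x|lborel. (smoothing \<mu> (rescale h sinc_kernel) x)\<^sup>2)) / real n
      \<le> \<epsilon> * real n powr (- (4 / 5))"
proof -
  interpret real_distribution \<mu> unfolding \<mu>_def by (rule real_distribution_density[OF f(1)])
  define S where "S = (LINT x|lborel. (sinc_kernel x)\<^sup>2)"
  have "S \<ge> 0" unfolding S_def by (intro Bochner_Integration.integral_nonneg) simp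
  define D where "D = 2 * S / \<epsilon> + 1"
  have D: "D > 0" "S / D \<le> \<epsilon> / 2"
    using \<open>S \<ge> 0\<close> \<open>\<epsilon> > 0\<close> by (auto simp: D_def field_simps intro: add_nonneg_pos)
  \<comment> \<open>The decay constant that yields a squared bias of at most half of the allowed risk.\<close>
  define \<eta> where "\<eta> = sqrt (\<epsilon> / D ^ 4)"
  have \<eta>: "\<eta> > 0" "\<eta>\<^sup>2 = \<epsilon> / D ^ 4" using \<open>\<epsilon> > 0\<close> D by (auto simp: \<eta>_def)
  have "\<forall>\<^sub>F t in at_top. norm (cmod (char \<mu> t)) \<le> \<eta> * norm (1 / t powr (5 / 2))"
    by (rule landau_o.smallD[OF decay \<eta>(1)])
  then obtain T0 where T0: "\<And>t. t \<ge> T0 \<Longrightarrow> cmod (char \<mu> t) \<le> \<eta> * t powr (- (5 / 2))"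
    by (auto simp: eventually_at_top_linorder powr_minus_divide)
  have char_int: "integrable lborel (char \<mu>)"
    by (rule integrable_char[of "5 / 2" "max T0 1" \<eta>]) (use T0 \<eta> in auto)
  have "filterlim (\<lambda>n. real n powr (1 / 5) / D) at_top sequentially"
    using D by real_asymp
  then have "\<forall>\<^sub>F n in sequentially. T0 \<le> real n powr (1 / 5) / D"
    by (simp add: filterlim_at_top)
  then show ?thesis
    using eventually_gt_at_top[of 0]
  proof eventually_elim
    case (elim n)
    define h where "h = D * real n powr (- (1 / 5))"
    have h: "h > 0" "1 / h = real n powr (1 / 5) / D"
      using D \<open>n > 0\<close> by (auto simp: h_def powr_minus_divide)
    let ?q = "rescale h sinc_kernel"
    let ?r = "real n powr (- (4 / 5))"
    have q: "square_integrable ?q" by (rule square_integrable_rescale[OF square_integrable_sinc h(1)])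
    have "h ^ 4 = D ^ 4 * ?r"
      using \<open>n > 0\<close> by (simp add: h_def power_mult_distrib powr_power)
    have "ennreal (LINT x|lborel. (smoothing \<mu> ?q x - f x)\<^sup>2)
       \<le> (\<integral>\<^sup>+t. ennreal ((cmod (char \<mu> t))\<^sup>2) * indicator (- {- (1 / h)<..1 / h}) t \<partial>lborel)"
      using sinc_bias_le_tail[OF f h(1)] char_int by (simp only: \<mu>_def)
    also have "\<dots> \<le> ennreal (2 * \<eta>\<^sup>2 * (1 / h) powr (1 - 5) / (5 - 1))"
    proof (rule nn_integral_two_sided_tail_le)
      fix t assume t: "1 / h \<le> t"
      have "(cmod (char \<mu> t))\<^sup>2 \<le> (\<eta> * t powr (- (5 / 2)))\<^sup>2"
        using T0[of t] t h elim by (intro power_mono) auto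
      also have "\<dots> = \<eta>\<^sup>2 * t powr (- 5)"
        using less_le_trans[OF _ t, of 0] h(1) by (simp add: power_mult_distrib powr_power)
      finally show "(cmod (char \<mu> t))\<^sup>2 \<le> \<eta>\<^sup>2 * t powr (- 5)" .
    qed (use h(1) cmod_char_minus in auto)
    also have "2 * \<eta>\<^sup>2 * (1 / h) powr (1 - 5) / (5 - 1) = \<eta>\<^sup>2 / 2 * h ^ 4"
      using h(1) by (simp add: powr_minus powr_numeral field_simps)
    also have "\<dots> = \<epsilon> / 2 * ?r"
      unfolding \<open>h ^ 4 = D ^ 4 * ?r\<close> \<eta>(2) using D by simp
    finally have bias: "(LINT x|lborel. (smoothing \<mu> ?q x - f x)\<^sup>2) \<le> \<epsilon> / 2 * ?r"
      using \<open>\<epsilon> > 0\<close> by (subst (asm) ennreal_le_iff) auto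
    have "0 \<le> (LINT x|lborel. (smoothing \<mu> ?q x)\<^sup>2)" by (intro Bochner_Integration.integral_nonneg) simp
    then have "((LINT x|lborel. (?q x)\<^sup>2) - (LINT x|lborel. (smoothing \<mu> ?q x)\<^sup>2)) / real n \<le> S / h / real n"
      unfolding rescale_L2[OF square_integrable_sinc h(1)] S_def by (intro divide_right_mono) auto
    also have "\<dots> = S / D * (real n powr (1 / 5) / n)"
      using D \<open>n > 0\<close> by (simp add: h_def powr_minus_divide)
    also have "real n powr (1 / 5) / n = ?r"
      using \<open>n > 0\<close> powr_diff[of "real n" "1 / 5" 1] by simp
    also have "S / D * ?r \<le> \<epsilon> / 2 * ?r" using D by (intro mult_right_mono) auto
    finally show ?case using bias h(1) by (intro exI[of _ h] conjI) linarith+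
  qed
qed

theorem theorem4p1:
  fixes M :: "'a measure" and X :: "nat \<Rightarrow> 'a \<Rightarrow> real" and f K :: "real \<Rightarrow> real"
    and \<phi> :: "real \<Rightarrow> complex"
  assumes "prob_space M"
    and "prob_space.indep_vars M (\<lambda>_. borel) X {1..}"
    and "\<And>j. j \<ge> 1 \<Longrightarrow> distributed M lborel (X j) (\<lambda>x. ennreal (f x))"
    and "prob_density f" and "square_integrable f"
    and "\<And>j t. j \<ge> 1 \<Longrightarrow> \<phi> t = char (distr M borel (X j)) t"
    and "prob_density K" and "square_integrable K" and "\<And>x. K (- x) = K x"
    and "(\<lambda>t. cmod (\<phi> t)) \<in> o[at_top](\<lambda>t. 1 / t powr (5 / 2))"
  shows "(\<lambda>n. enn2real (INF h\<in>{0<..}. MISE M (\<lambda>\<omega>. sinc_estimator (\<lambda>j. X j \<omega>) n h) f))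
           \<in> o(\<lambda>n. enn2real (INF h\<in>{0<..}. MISE M (\<lambda>\<omega>. kernel_estimator K (\<lambda>j. X j \<omega>) n h) f))"
proof -
  define \<mu> where "\<mu> = density lborel (\<lambda>x. ennreal (f x))"
  interpret \<mu>: real_distribution \<mu>
    unfolding \<mu>_def by (rule real_distribution_density[OF assms(4)])
  have law: "distr M borel (X j) = \<mu>" if "j \<ge> 1" for j
  proof -
    have "distr M borel (X j) = distr M lborel (X j)" by (rule distr_cong) auto
    then show ?thesis using distributed_distr_eq_density[OF assms(3)[OF that]] by (simp add: \<mu>_def)
  qed
  have \<phi>: "\<phi> = char \<mu>" using assms(6)[of 1] law[of 1] by auto
  define risk where "risk L n h = (LINT x|lborel. (smoothing \<mu> (rescale h L) x - f x)\<^sup>2)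
      + ((LINT x|lborel. (rescale h L x)\<^sup>2) - (LINT x|lborel. (smoothing \<mu> (rescale h L) x)\<^sup>2)) / real n"
    for L n h
  have MISE: "MISE M (\<lambda>\<omega>. kernel_estimator L (\<lambda>j. X j \<omega>) n h) f = ennreal (risk L n h)"
    if "square_integrable L" "n > 0" "h > 0" for L n h
    unfolding kernel_estimator_rescale[abs_def] risk_def
    by (rule MISE_sample_average[OF assms(1,2) law \<mu>.real_distribution_axioms
          square_integrable_rescale[OF that(1,3)] assms(5) that(2)])
  define best where "best L n = enn2real (INF h\<in>{0<..}. MISE M (\<lambda>\<omega>. kernel_estimator L (\<lambda>j. X j \<omega>) n h) f)" for L n
  have best_eq: "best L n = enn2real (INF h\<in>{0<..}. ennreal (risk L n h))" if "square_integrable L" "n > 0" for L n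
    unfolding best_def by (intro arg_cong[where f = enn2real] INF_cong) (simp_all add: MISE[OF that])
  obtain C where "C > 0" and lower: "\<And>n h. n > 0 \<Longrightarrow> h > 0 \<Longrightarrow> C * real n powr (- (4 / 5)) \<le> risk K n h"
    unfolding risk_def \<mu>_def using kernel_risk_lower_bound[OF assms(4,5,7,8)] by blast
  have best_lower: "C * real n powr (- (4 / 5)) \<le> best K n" if "n > 0" for n
  proof -
    let ?I = "INF h\<in>{0<..}. ennreal (risk K n h)"
    have "ennreal (C * real n powr (- (4 / 5))) \<le> ?I"
      using lower[OF that] by (intro INF_greatest ennreal_leI) auto
    moreover have "?I \<le> ennreal (risk K n 1)" by (rule INF_lower) simp
    then have "?I < top" using ennreal_less_top le_less_trans by blast
    ultimately have "enn2real (ennreal (C * real n powr (- (4 / 5)))) \<le> enn2real ?I"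
      by (rule enn2real_mono)
    then show ?thesis using \<open>C > 0\<close> by (simp add: best_eq[OF assms(8) that])
  qed
  have "(\<lambda>n. best sinc_kernel n) \<in> o(\<lambda>n. best K n)"
  proof (rule landau_o.smallI)
    fix c :: real assume "c > 0"
    have "\<forall>\<^sub>F n in sequentially. \<exists>h>0. risk sinc_kernel n h \<le> c * C * real n powr (- (4 / 5))"
      using sinc_risk_upper_bound[OF assms(4,5), of "c * C"] assms(10) \<open>c > 0\<close> \<open>C > 0\<close>
      unfolding risk_def \<mu>_def[symmetric] \<phi> by simp
    then show "\<forall>\<^sub>F n in sequentially. norm (best sinc_kernel n) \<le> c * norm (best K n)"
      using eventually_gt_at_top[of 0]
    proof eventually_elim
      case (elim n)
      then obtain h where h: "h > 0" "risk sinc_kernel n h \<le> c * C * real n powr (- (4 / 5))" by blast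
      have "(INF h\<in>{0<..}. ennreal (risk sinc_kernel n h)) \<le> ennreal (risk sinc_kernel n h)"
        by (rule INF_lower) (simp add: h)
      also have "\<dots> \<le> ennreal (c * (C * real n powr (- (4 / 5))))"
        using h(2) by (intro ennreal_leI) (simp add: mult.assoc)
      finally have "best sinc_kernel n \<le> c * (C * real n powr (- (4 / 5)))"
        unfolding best_eq[OF square_integrable_sinc \<open>0 < n\<close>]
        using \<open>c > 0\<close> \<open>C > 0\<close> by (intro enn2real_leI) auto
      also have "\<dots> \<le> c * best K n" using best_lower[OF \<open>0 < n\<close>] \<open>c > 0\<close> by (intro mult_left_mono) auto
      finally show ?case by (simp add: best_def)
    qed
  qed
  then show ?thesis by (simp only: best_def sinc_estimator_def[abs_def])
qed

end
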